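(* Let $p\in\,]-1,1[$ be a nonzero real number and let $H$ be a complex Hilbert space of dimension at least $2$. Then there is no bijective map $\phi:B(H)^+\to B(H)^+$ such that \[ \phi(A\,\mathsf{m}_p\, B)=\phi(A)\,\mathfrak{m}_p\, \phi(B)\quad\text{for all } A,B\in B(H)^+. \]
   Context: $]-1,1[$ denotes the open interval. $B(H)^+$ is the set of all bounded positive semidefinite linear operators on $H$; positive powers of its elements are defined by continuous functional calculus. For nonzero $r\in[-1,1]$, the Kubo-Ando $r$th power mean $\mathfrak{m}_r$ on $B(H)^+$ is the Kubo-Ando mean with representing operator monotone function $t\mapsto\left(\frac{1+t^r}{2}\right)^{1/r}$, $t>0$. Concretely, for invertible $A,B\in B(H)^+$, \[ A\,\mathfrak{m}_r\, B=A^{\frac12}\left(\frac{I+(A^{-\frac12} B A^{-\frac12})^r}{2}\right)^{\frac1r} A^{\frac12}, \] and for general $A,B\in B(H)^+$, $A\,\mathfrak{m}_r\,B$ is the limit in the strong operator topology of the (monotone decreasing) net $(A+\varepsilon I)\,\mathfrak{m}_r\,(B+\varepsilon I)$ as $\varepsilon\downarrow 0$. In particular, $\mathfrak{m}_{-1}$ is the harmonic mean, with $A\,\mathfrak{m}_{-1}\,B=2(A^{-1}+B^{-1})^{-1}$ for invertible $A,B$. The conventional $p$th power mean $\mathsf{m}_p$ on $B(H)^+$ is defined, for $0<p<1$, by \[ A\,\mathsf{m}_p\, B=\left(\frac{A^p+B^p}{2}\right)^{\frac1p},\quad A,B\in B(H)^+, \] and, for $-1<p<0$, with $q=-p$, by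 \[ A\,\mathsf{m}_p\, B=\left(A^q\,\mathfrak{m}_{-1}\, B^q\right)^{\frac1q},\quad A,B\in B(H)^+. \] *)

theory Defs
  imports "HOL-Analysis.Analysis" "HOL-Computational_Algebra.Polynomial"
begin

text \<open>
  The library has only real inner product spaces.  A complex Hilbert space is a complete real
  inner product space with a compatible complex structure: \<open>inner\<close> is the real part of the complex
  inner product, so \<open>norm x = sqrt (Re (cinner x x))\<close>, and \<open>cinner\<close> is linear in its first argument.
  Positive definiteness of \<open>cinner\<close> follows from that of \<open>inner\<close> and \<open>cinner_commute\<close>.
\<close>

class complex_hilbert_space = real_inner + banach +
  fixes scaleC :: "complex \<Rightarrow> 'a \<Rightarrow> 'a" (infixr \<open>*\<^sub>C\<close> 75)
    and cinner :: "'a \<Rightarrow> 'a \<Rightarrow> complex"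
  assumes scaleC_add_right: "a *\<^sub>C (x + y) = a *\<^sub>C x + a *\<^sub>C y"
    and scaleC_add_left: "(a + b) *\<^sub>C x = a *\<^sub>C x + b *\<^sub>C x"
    and scaleC_scaleC: "a *\<^sub>C (b *\<^sub>C x) = (a * b) *\<^sub>C x"
    and scaleC_one: "1 *\<^sub>C x = x"
    and scaleR_scaleC: "r *\<^sub>R x = complex_of_real r *\<^sub>C x"
    and cinner_add_left: "cinner (x + y) z = cinner x z + cinner y z"
    and cinner_scaleC_left: "cinner (a *\<^sub>C x) y = a * cinner x y"
    and cinner_commute: "cinner x y = cnj (cinner y x)"
    and inner_eq_Re_cinner: "inner x y = Re (cinner x y)"

global_interpretation complex_vector:
  vector_space "scaleC :: complex \<Rightarrow> 'a \<Rightarrow> 'a::complex_hilbert_space"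
  by unfold_locales (simp_all add: scaleC_add_right scaleC_add_left scaleC_scaleC scaleC_one)

text \<open>\<open>B(H)\<close>: the elements of \<^typ>\<open>'a \<Rightarrow>\<^sub>L 'a\<close> are only real-linear in general.\<close>

definition bounded_ops :: "('a::complex_hilbert_space \<Rightarrow>\<^sub>L 'a) set" where
  "bounded_ops = {T. \<forall>c x. blinfun_apply T (c *\<^sub>C x) = c *\<^sub>C blinfun_apply T x}"

definition pos_ops :: "('a::complex_hilbert_space \<Rightarrow>\<^sub>L 'a) set" where
  "pos_ops = {A \<in> bounded_ops.
     \<forall>x. Im (cinner (blinfun_apply A x) x) = 0 \<and> 0 \<le> Re (cinner (blinfun_apply A x) x)}"

definition spectrum :: "('a::complex_hilbert_space \<Rightarrow>\<^sub>L 'a) \<Rightarrow> complex set" where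
  "spectrum A = {z. \<not> (\<exists>B \<in> bounded_ops. \<forall>x.
     blinfun_apply B (blinfun_apply A x - z *\<^sub>C x) = x \<and>
     blinfun_apply A (blinfun_apply B x) - z *\<^sub>C blinfun_apply B x = x)}"

definition poly_op :: "real poly \<Rightarrow> ('a::complex_hilbert_space \<Rightarrow>\<^sub>L 'a) \<Rightarrow> ('a \<Rightarrow>\<^sub>L 'a)" where
  "poly_op p A = (\<Sum>i\<le>degree p. coeff p i *\<^sub>R (((o\<^sub>L) A ^^ i) id_blinfun))"

text \<open>
  Continuous functional calculus for a self-adjoint \<open>A\<close> (so that the spectrum is a compact set of
  real numbers) and a real function \<open>f\<close> that is continuous on the spectrum: \<open>f(A)\<close> is the norm
  limit of \<open>p\<^sub>n(A)\<close> for every sequence of polynomials \<open>p\<^sub>n\<close> converging to \<open>f\<close> uniformly on the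
  spectrum.  Such sequences exist by the Weierstrass theorem.
\<close>

definition fun_calc :: "(real \<Rightarrow> real) \<Rightarrow> ('a::complex_hilbert_space \<Rightarrow>\<^sub>L 'a) \<Rightarrow> ('a \<Rightarrow>\<^sub>L 'a)" where
  "fun_calc f A = (THE T. \<forall>p.
     uniform_limit {t. complex_of_real t \<in> spectrum A} (\<lambda>n. poly (p n)) f sequentially \<longrightarrow>
     (\<lambda>n. poly_op (p n) A) \<longlonglongrightarrow> T)"

text \<open>
  Here \<open>A\<close> is positive, and invertible if \<open>r < 0\<close>; note that \<open>0 powr r = 0\<close>, which is the correct
  continuous value for \<open>r > 0\<close>.
\<close>

definition op_powr ::
    "('a::complex_hilbert_space \<Rightarrow>\<^sub>L 'a) \<Rightarrow> real \<Rightarrow> ('a \<Rightarrow>\<^sub>L 'a)" (infixr \<open>opowr\<close> 80) where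
  "A opowr r = fun_calc (\<lambda>t. t powr r) A"

definition kubo_ando_mean_inv ::
    "real \<Rightarrow> ('a::complex_hilbert_space \<Rightarrow>\<^sub>L 'a) \<Rightarrow> ('a \<Rightarrow>\<^sub>L 'a) \<Rightarrow> ('a \<Rightarrow>\<^sub>L 'a)" where
  "kubo_ando_mean_inv r A B =
     A opowr (1/2) o\<^sub>L
     ((1/2) *\<^sub>R (id_blinfun + (A opowr (-1/2) o\<^sub>L B o\<^sub>L A opowr (-1/2)) opowr r)) opowr (1/r) o\<^sub>L
     A opowr (1/2)"

text \<open>
  For all positive \<open>A\<close> and \<open>B\<close> the mean is the strong limit; for invertible ones it coincides with
  \<^const>\<open>kubo_ando_mean_inv\<close>.
\<close>

definition kubo_ando_power_mean ::
    "real \<Rightarrow> ('a::complex_hilbert_space \<Rightarrow>\<^sub>L 'a) \<Rightarrow> ('a \<Rightarrow>\<^sub>L 'a) \<Rightarrow> ('a \<Rightarrow>\<^sub>L 'a)" where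
  "kubo_ando_power_mean r A B = (THE T. \<forall>x.
     ((\<lambda>\<epsilon>. blinfun_apply
              (kubo_ando_mean_inv r (A + \<epsilon> *\<^sub>R id_blinfun) (B + \<epsilon> *\<^sub>R id_blinfun)) x)
       \<longlongrightarrow> blinfun_apply T x) (at_right 0))"

definition conventional_power_mean ::
    "real \<Rightarrow> ('a::complex_hilbert_space \<Rightarrow>\<^sub>L 'a) \<Rightarrow> ('a \<Rightarrow>\<^sub>L 'a) \<Rightarrow> ('a \<Rightarrow>\<^sub>L 'a)" where
  "conventional_power_mean p A B =
     (if 0 < p then ((1/2) *\<^sub>R (A opowr p + B opowr p)) opowr (1/p)
      else kubo_ando_power_mean (-1) (A opowr (-p)) (B opowr (-p)) opowr (1/(-p)))"

end

theory Submission
  imports Defs "HOL-Computational_Algebra.Fundamental_Theorem_Algebra"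
begin

text \<open>
  The arithmetic and the harmonic mean of positive operators satisfy the bisymmetry law
  \<open>(A \<circ> B) \<circ> (C \<circ> D) = (A \<circ> C) \<circ> (B \<circ> D)\<close>; for the harmonic mean this follows from the variational
  formula \<open>\<langle>(A \<circ> B) x, x\<rangle> = inf\<^sub>y 2 \<langle>A y, y\<rangle> + 2 \<langle>B (x - y), x - y\<rangle>\<close>.  Hence the conventional power
  mean, which is one of the two in the coordinate \<open>A\<^bsup>\<bar>p\<bar>\<^esup>\<close>, is bisymmetric, and \<open>\<phi>\<close> would transport
  the law to the Kubo--Ando power mean.  The latter can be computed explicitly when the second
  argument has rank one, and for two projections onto non-parallel, non-orthogonal vectors the law
  fails by strict concavity of the scalar power mean.
\<close>

subsection \<open>Complex inner products and self-adjoint operators\<close>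

text \<open>The calculus \<open>fun_calc\<close> quantifies over all polynomial sequences that
  converge on the spectrum, so everything rests on bounding the norm of q(A) by the supremum of |q|
  on the real spectrum. That bound comes from the roots of a single complex polynomial, without
  spectral measures. Afterwards operators are controlled through order intervals aI <= A <= bI and
  functions continuous on [a,b].

  The second obstacle is that the means of noninvertible operators exist only as strong limits. For
  the harmonic mean, monotonicity gives the limit, and the infimum formula survives although a
  minimizer may be lost. For the counterexample it suffices to treat an invertible first argument,
  where the regularized means converge in norm, and pairs of multiples of one projection.

  Putting the identity in the first place keeps the inner means in the span of a projection and its
  complement, so both sides reduce to scalars. The sign of p decides the test: the representing
  function is positive at 0 for p > 0 but vanishes there for p < 0, and then the test with the zero
  operator would only say 0 = 0.\<close>

lemma cinner_add_right: "cinner x (y + z) = cinner x y + cinner x z"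
  by (metis cinner_add_left cinner_commute complex_cnj_add)

lemma cinner_scaleC_right: "cinner x (a *\<^sub>C y) = cnj a * cinner x y"
  by (metis cinner_commute cinner_scaleC_left complex_cnj_mult)

lemma cinner_diff_left: "cinner (x - y) z = cinner x z - cinner y z"
  by (metis add_diff_cancel_right' cinner_add_left diff_add_cancel)

lemma Im_cinner: "Im (cinner x y) = inner x (\<i> *\<^sub>C y)"
  by (simp add: inner_eq_Re_cinner cinner_scaleC_right)

lemma cinner_self: "cinner x x = complex_of_real ((norm x)\<^sup>2)"
proof (rule complex_eqI)
  show "Re (cinner x x) = Re (complex_of_real ((norm x)\<^sup>2))"
    by (simp add: inner_eq_Re_cinner [symmetric] power2_norm_eq_inner)
  have "Im (cinner x x) = Im (cnj (cinner x x))"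
    by (metis cinner_commute)
  then show "Im (cinner x x) = Im (complex_of_real ((norm x)\<^sup>2))"
    by simp
qed

lemma norm_scaleC: "norm (c *\<^sub>C x) = cmod c * norm x"
proof -
  have "complex_of_real ((norm (c *\<^sub>C x))\<^sup>2) = c * cnj c * complex_of_real ((norm x)\<^sup>2)"
    by (metis cinner_self cinner_scaleC_left cinner_scaleC_right mult.assoc)
  also have "\<dots> = complex_of_real ((cmod c * norm x)\<^sup>2)"
    by (simp add: complex_norm_square [symmetric] power_mult_distrib)
  finally have "(norm (c *\<^sub>C x))\<^sup>2 = (cmod c * norm x)\<^sup>2"
    using of_real_eq_iff by blast
  then show ?thesis
    by (simp add: power2_eq_iff_nonneg)
qed

lemma cinner_Cauchy_Schwarz: "cmod (cinner x y) \<le> norm x * norm y"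
proof (cases "cinner x y = 0")
  case False
  \<comment> \<open>The factor c rotates x until its product with y is real and nonnegative, so that
    the real Cauchy-Schwarz inequality applies.\<close>
  define c where "c = cnj (sgn (cinner x y))"
  have "cmod c = 1"
    using False by (simp add: c_def norm_sgn)
  have "cinner (c *\<^sub>C x) y = complex_of_real (cmod (cinner x y))"
    by (simp add: c_def cinner_scaleC_left sgn_eq complex_norm_square [symmetric] power2_eq_square
        field_simps)
  then have "cmod (cinner x y) = inner (c *\<^sub>C x) y"
    by (simp add: inner_eq_Re_cinner)
  also have "\<dots> \<le> norm (c *\<^sub>C x) * norm y"
    by (rule norm_cauchy_schwarz)
  finally show ?thesis
    by (simp add: norm_scaleC \<open>cmod c = 1\<close>)
qed simp

lemma bounded_opsD: "T \<in> bounded_ops \<Longrightarrow> T (c *\<^sub>C x) = c *\<^sub>C T x"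
  by (simp add: bounded_ops_def)

lemma bounded_ops_compose: "S \<in> bounded_ops \<Longrightarrow> T \<in> bounded_ops \<Longrightarrow> S o\<^sub>L T \<in> bounded_ops"
  by (simp add: bounded_ops_def)

lemma scaleR_scaleC_commute: "r *\<^sub>R c *\<^sub>C x = c *\<^sub>C r *\<^sub>R (x :: 'a::complex_hilbert_space)"
  by (simp add: scaleR_scaleC scaleC_scaleC mult.commute)

lemma bounded_ops_add: "S \<in> bounded_ops \<Longrightarrow> T \<in> bounded_ops \<Longrightarrow> S + T \<in> bounded_ops"
  by (simp add: bounded_ops_def blinfun.add_left scaleC_add_right)

lemma bounded_ops_scaleR: "T \<in> bounded_ops \<Longrightarrow> r *\<^sub>R T \<in> bounded_ops"
  by (simp add: bounded_ops_def blinfun.scaleR_left scaleR_scaleC_commute)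

text \<open>Symmetry for the real inner product is enough: with complex linearity it also fixes the
  imaginary part, which is a real product with \<open>\<i> *\<^sub>C y\<close> (see
  \<open>sa_ops_cinner\<close>).\<close>

definition sa_ops :: "('a::complex_hilbert_space \<Rightarrow>\<^sub>L 'a) set" where
  "sa_ops = {A \<in> bounded_ops. \<forall>x y. inner (A x) y = inner x (A y)}"

lemma sa_ops_bounded: "A \<in> sa_ops \<Longrightarrow> A \<in> bounded_ops"
  by (simp add: sa_ops_def)

lemma sa_opsD: "A \<in> sa_ops \<Longrightarrow> inner (A x) y = inner x (A y)"
  by (simp add: sa_ops_def)

lemma sa_ops_cinner:
  assumes "A \<in> sa_ops"
  shows "cinner (A x) y = cinner x (A y)"
proof (rule complex_eqI)
  show "Re (cinner (A x) y) = Re (cinner x (A y))"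
    using sa_opsD [OF assms] by (simp add: inner_eq_Re_cinner)
  show "Im (cinner (A x) y) = Im (cinner x (A y))"
    using sa_opsD [OF assms, of x "\<i> *\<^sub>C y"] assms
    by (simp add: Im_cinner bounded_opsD sa_ops_bounded)
qed

lemma sa_ops_add: "S \<in> sa_ops \<Longrightarrow> T \<in> sa_ops \<Longrightarrow> S + T \<in> sa_ops"
  by (simp add: sa_ops_def bounded_ops_add blinfun.add_left inner_add)

lemma sa_ops_scaleR: "T \<in> sa_ops \<Longrightarrow> r *\<^sub>R T \<in> sa_ops"
  by (simp add: sa_ops_def bounded_ops_scaleR blinfun.scaleR_left)

lemma sa_ops_diff: "S \<in> sa_ops \<Longrightarrow> T \<in> sa_ops \<Longrightarrow> S - T \<in> sa_ops"
  using sa_ops_add [of S "(-1) *\<^sub>R T"] sa_ops_scaleR [of T "-1"] by simp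

lemma sa_ops_id: "id_blinfun \<in> sa_ops"
  by (simp add: sa_ops_def bounded_ops_def)

lemma sa_ops_compose:
  assumes "S \<in> sa_ops" "T \<in> sa_ops" "S o\<^sub>L T = T o\<^sub>L S"
  shows "S o\<^sub>L T \<in> sa_ops"
proof -
  have "inner (S (T x)) y = inner x (S (T y))" for x y
  proof -
    have "S (T y) = T (S y)"
      using assms(3) by (metis blinfun_apply_blinfun_compose)
    then show ?thesis
      using assms(1,2) by (simp add: sa_opsD)
  qed
  then show ?thesis
    using assms by (simp add: sa_ops_def bounded_ops_compose)
qed

lemma sa_ops_conjugate: "S \<in> sa_ops \<Longrightarrow> T \<in> sa_ops \<Longrightarrow> S o\<^sub>L T o\<^sub>L S \<in> sa_ops"
  by (simp add: sa_ops_def bounded_ops_compose)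

lemma bounded_linear_scaleC: "bounded_linear (\<lambda>x :: 'a::complex_hilbert_space. c *\<^sub>C x)"
  by (rule bounded_linear_intro [where K = "cmod c"])
    (simp_all add: scaleC_add_right scaleR_scaleC_commute norm_scaleC)

text \<open>The filter is general because the lemma serves both norm limits of sequences
  (\<open>closed_sa_ops\<close>) and the strong limit at 0 from the right in
  \<open>monotone_strong_limit\<close>.\<close>

lemma sa_ops_strong_limit:
  fixes T :: "'a::complex_hilbert_space \<Rightarrow>\<^sub>L 'a"
  assumes F: "F \<noteq> bot" and S: "\<forall>\<^sub>F i in F. S i \<in> sa_ops"
    and lim: "\<And>x. ((\<lambda>i. S i x) \<longlongrightarrow> T x) F"
  shows "T \<in> sa_ops"
proof -
  have "T (c *\<^sub>C x) = c *\<^sub>C T x" for c x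
  proof (rule tendsto_unique [OF F lim])
    have "((\<lambda>i. c *\<^sub>C S i x) \<longlongrightarrow> c *\<^sub>C T x) F"
      by (rule bounded_linear.tendsto [OF bounded_linear_scaleC lim])
    then show "((\<lambda>i. S i (c *\<^sub>C x)) \<longlongrightarrow> c *\<^sub>C T x) F"
      by (rule Lim_transform_eventually)
        (use S in \<open>auto elim!: eventually_mono simp: bounded_opsD sa_ops_bounded\<close>)
  qed
  moreover have "inner (T x) y = inner x (T y)" for x y
  proof (rule tendsto_unique [OF F])
    show "((\<lambda>i. inner (S i x) y) \<longlongrightarrow> inner (T x) y) F"
      by (intro tendsto_intros lim)
    have "((\<lambda>i. inner x (S i y)) \<longlongrightarrow> inner x (T y)) F"
      by (intro tendsto_intros lim)
    then show "((\<lambda>i. inner (S i x) y) \<longlongrightarrow> inner x (T y)) F"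
      by (rule Lim_transform_eventually) (use S in \<open>auto elim!: eventually_mono simp: sa_opsD\<close>)
  qed
  ultimately show ?thesis
    by (simp add: sa_ops_def bounded_ops_def)
qed

lemma closed_sa_ops: "closed (sa_ops :: ('a::complex_hilbert_space \<Rightarrow>\<^sub>L 'a) set)"
  unfolding closed_sequential_limits
  by (auto intro!: sa_ops_strong_limit [OF sequentially_bot] tendsto_intros)

lemma pos_ops_iff: "A \<in> pos_ops \<longleftrightarrow> A \<in> sa_ops \<and> (\<forall>x. 0 \<le> inner (A x) x)"
proof
  assume A: "A \<in> pos_ops"
  then have "A \<in> bounded_ops" and im: "Im (cinner (A x) x) = 0" for x
    by (auto simp: pos_ops_def)
  \<comment> \<open>Polarization; replacing y by its multiple by the imaginary unit turns this
    relation between imaginary parts into equality of real parts.\<close>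
  have *: "Im (cinner (A x) y) + Im (cinner (A y) x) = 0" for x y
    using im [of "x + y"] im [of x] im [of y]
    by (simp add: cinner_add_left cinner_add_right blinfun.add_right)
  have "inner (A x) y = inner x (A y)" for x y
  proof -
    have "Re (cinner (A x) y) = Re (cinner (A y) x)"
      using * [of x "\<i> *\<^sub>C y"] \<open>A \<in> bounded_ops\<close>
      by (simp add: bounded_opsD cinner_scaleC_left cinner_scaleC_right)
    then show ?thesis
      by (simp add: inner_eq_Re_cinner [symmetric] inner_commute)
  qed
  then show "A \<in> sa_ops \<and> (\<forall>x. 0 \<le> inner (A x) x)"
    using A by (simp add: sa_ops_def pos_ops_def inner_eq_Re_cinner)
next
  assume A: "A \<in> sa_ops \<and> (\<forall>x. 0 \<le> inner (A x) x)"
  have "Im (cinner (A x) x) = 0" for x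
  proof -
    have "cinner (A x) x = cnj (cinner (A x) x)"
      using sa_ops_cinner [of A x x] A cinner_commute [of "A x" x] by simp
    then have "Im (cinner (A x) x) = Im (cnj (cinner (A x) x))"
      by (rule arg_cong)
    then show ?thesis
      by simp
  qed
  then show "A \<in> pos_ops"
    using A by (simp add: pos_ops_def sa_ops_bounded inner_eq_Re_cinner)
qed

text \<open>The order interval aI <= A <= bI. Such bounds are easy to propagate through sums and
  conjugations, and they confine the real spectrum to [a,b]
  (\<open>spectrum_between\<close>).\<close>

definition ops_between :: "real \<Rightarrow> real \<Rightarrow> ('a::complex_hilbert_space \<Rightarrow>\<^sub>L 'a) set" where
  "ops_between a b =
     {A \<in> sa_ops. \<forall>x. a * (norm x)\<^sup>2 \<le> inner (A x) x \<and> inner (A x) x \<le> b * (norm x)\<^sup>2}"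

lemma ops_between_sa: "A \<in> ops_between a b \<Longrightarrow> A \<in> sa_ops"
  by (simp add: ops_between_def)

lemma ops_betweenD:
  assumes "A \<in> ops_between a b"
  shows "a * (norm x)\<^sup>2 \<le> inner (A x) x" "inner (A x) x \<le> b * (norm x)\<^sup>2"
  using assms by (simp_all add: ops_between_def)

lemma ops_between_mono:
  assumes "A \<in> ops_between a b" "a' \<le> a" "b \<le> b'"
  shows "A \<in> ops_between a' b'"
proof -
  have "a' * (norm x)\<^sup>2 \<le> a * (norm x)\<^sup>2" "b * (norm x)\<^sup>2 \<le> b' * (norm x)\<^sup>2" for x :: 'a
    using assms by (simp_all add: mult_right_mono)
  then show ?thesis
    using assms(1) unfolding ops_between_def by (auto intro: order_trans)
qed

lemma inner_blinfun_le:
  fixes A :: "'a::real_inner \<Rightarrow>\<^sub>L 'a"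
  shows "\<bar>inner (A x) x\<bar> \<le> norm A * (norm x)\<^sup>2"
proof -
  have "\<bar>inner (A x) x\<bar> \<le> norm (A x) * norm x"
    by (rule Cauchy_Schwarz_ineq2)
  also have "\<dots> \<le> norm A * norm x * norm x"
    by (intro mult_right_mono norm_blinfun) auto
  finally show ?thesis
    by (simp add: power2_eq_square mult.assoc)
qed

lemma sa_ops_between: "A \<in> sa_ops \<Longrightarrow> A \<in> ops_between (- norm A) (norm A)"
  using inner_blinfun_le [of A] by (auto simp: ops_between_def abs_le_iff minus_le_iff)

lemma pos_ops_between: "A \<in> pos_ops \<Longrightarrow> A \<in> ops_between 0 (norm A)"
  using inner_blinfun_le [of A] by (auto simp: pos_ops_iff ops_between_def abs_le_iff)

lemma ops_between_pos: "A \<in> ops_between a b \<Longrightarrow> 0 \<le> a \<Longrightarrow> A \<in> pos_ops"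
  by (auto simp: pos_ops_iff ops_between_def intro: order_trans [rotated])

lemma ops_between_add:
  "S \<in> ops_between a b \<Longrightarrow> T \<in> ops_between c d \<Longrightarrow> S + T \<in> ops_between (a + c) (b + d)"
  by (simp add: ops_between_def sa_ops_add blinfun.add_left inner_add_left distrib_right add_mono)

lemma ops_between_scaleR: "S \<in> ops_between a b \<Longrightarrow> 0 \<le> r \<Longrightarrow> r *\<^sub>R S \<in> ops_between (r * a) (r * b)"
  by (simp add: ops_between_def sa_ops_scaleR blinfun.scaleR_left mult.assoc mult_left_mono)

lemma ops_between_id: "id_blinfun \<in> ops_between 1 1"
  by (simp add: ops_between_def sa_ops_id power2_norm_eq_inner)

lemma ops_between_add_id:
  assumes "S \<in> ops_between a b" "0 \<le> r"
  shows "S + r *\<^sub>R id_blinfun \<in> ops_between (a + r) (b + r)"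
  using ops_between_add [OF assms(1) ops_between_scaleR [OF ops_between_id assms(2)]] by simp

text \<open>Positivity of the form of S at x - Sx/c, expanded. It converts a small quadratic form
  into a small vector, which yields norm bounds, equality of operators from equality of forms, and
  strong convergence of monotone nets.\<close>

lemma ops_between_norm_sq_le:
  assumes "S \<in> ops_between 0 c" "0 < c"
  shows "(norm (S x))\<^sup>2 \<le> c * inner (S x) x"
proof -
  define y where "y = x - (1/c) *\<^sub>R S x"
  have "0 \<le> inner (S y) y"
    using ops_betweenD(1) [OF assms(1), of y] by simp
  also have "inner (S y) y = inner (S x) x - (2/c) * (norm (S x))\<^sup>2 + (1/c)\<^sup>2 * inner (S (S x)) (S x)"
    using sa_opsD [OF ops_between_sa [OF assms(1)], of "S x" x] assms(2)
    unfolding power2_norm_eq_inner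
    by (simp add: y_def blinfun.diff_right blinfun.scaleR_right inner_diff inner_commute
        power2_eq_square field_simps)
  also have "(1/c)\<^sup>2 * inner (S (S x)) (S x) \<le> (1/c)\<^sup>2 * (c * (norm (S x))\<^sup>2)"
    by (intro mult_left_mono ops_betweenD(2) [OF assms(1)]) auto
  also have "\<dots> = (1/c) * (norm (S x))\<^sup>2"
    using assms(2) by (simp add: power2_eq_square)
  finally show ?thesis
    using assms(2) by (simp add: field_simps)
qed

lemma ops_between_norm_le:
  assumes "S \<in> ops_between 0 c" "0 < c"
  shows "norm S \<le> c"
proof (rule norm_blinfun_bound)
  fix x
  have "(norm (S x))\<^sup>2 \<le> c * (c * (norm x)\<^sup>2)"
    using ops_between_norm_sq_le [OF assms, of x] ops_betweenD(2) [OF assms(1), of x] assms(2)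
    by (meson mult_left_mono less_imp_le order_trans)
  then have "(norm (S x))\<^sup>2 \<le> (c * norm x)\<^sup>2"
    by (simp add: power2_eq_square algebra_simps)
  then show "norm (S x) \<le> c * norm x"
    using assms(2) by (simp add: power2_le_iff_abs_le)
qed (use assms(2) in simp)

lemma sa_ops_eqI:
  assumes "S \<in> sa_ops" "T \<in> sa_ops" "\<And>x. inner (S x) x = inner (T x) x"
  shows "S = T"
proof -
  have "S - T \<in> ops_between 0 1"
    using assms by (simp add: ops_between_def sa_ops_diff blinfun.diff_left inner_diff_left)
  then have "(norm ((S - T) x))\<^sup>2 \<le> 1 * inner ((S - T) x) x" for x
    by (rule ops_between_norm_sq_le) simp
  then have "(norm (S x - T x))\<^sup>2 \<le> 0" for x
    using assms(3) [of x] by (metis blinfun.diff_left inner_diff_left diff_self mult_1)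
  then have "S x = T x" for x
    by simp
  then show ?thesis
    by (rule blinfun_eqI)
qed

lemma ops_between_conjugate:
  assumes "S \<in> sa_ops" "T \<in> ops_between 0 b" "0 \<le> b"
  shows "S o\<^sub>L T o\<^sub>L S \<in> ops_between 0 (b * (norm S)\<^sup>2)"
proof -
  have "0 \<le> inner (S (T (S x))) x \<and> inner (S (T (S x))) x \<le> b * (norm S)\<^sup>2 * (norm x)\<^sup>2" for x
  proof -
    have eq: "inner (S (T (S x))) x = inner (T (S x)) (S x)"
      using assms(1) by (simp add: sa_opsD)
    have "(norm (S x))\<^sup>2 \<le> (norm S * norm x)\<^sup>2"
      by (intro power_mono norm_blinfun) auto
    then have "b * (norm (S x))\<^sup>2 \<le> b * (norm S)\<^sup>2 * (norm x)\<^sup>2"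
      using assms(3) by (metis mult.assoc mult_left_mono power_mult_distrib)
    then show ?thesis
      using ops_betweenD [OF assms(2), of "S x"] by (simp add: eq)
  qed
  then show ?thesis
    using sa_ops_conjugate [OF assms(1) ops_between_sa [OF assms(2)]]
    by (simp add: ops_between_def)
qed

subsection \<open>The spectrum of a self-adjoint operator\<close>

text \<open>The Lax-Milgram argument: a solution of Tx = y is a fixed point of x + \<tau>(y - Tx),
  which is a contraction for suitable \<tau>, and coercivity bounds the inverse by 1/c.\<close>

lemma coercive_invertible:
  fixes T :: "'a::complex_hilbert_space \<Rightarrow>\<^sub>L 'a"
  assumes T: "T \<in> bounded_ops" and "0 < c" and coercive: "\<And>x. c * (norm x)\<^sup>2 \<le> inner (T x) x"
  shows "\<exists>B \<in> bounded_ops. \<forall>x. B (T x) = x \<and> T (B x) = x"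
proof -
  \<comment> \<open>Adding c ensures 0 < c <= K even in the zero space, where the norm of T is
    0.\<close>
  define K where "K = norm T + c"
  have K: "0 < K" "c \<le> K" "norm T \<le> K"
    using \<open>0 < c\<close> by (simp_all add: K_def add_nonneg_pos)
  \<comment> \<open>This value minimizes 1 - 2\<tau>c + \<tau>^2 K^2, the bound for the squared
    contraction factor; the minimum is 1 - c^2/K^2.\<close>
  define \<tau> where "\<tau> = c / K\<^sup>2"
  define k where "k = sqrt (1 - c\<^sup>2 / K\<^sup>2)"
  have "c\<^sup>2 \<le> K\<^sup>2"
    using K \<open>0 < c\<close> by (simp add: power_mono)
  then have k: "0 \<le> k" "k < 1" "k\<^sup>2 = 1 - c\<^sup>2 / K\<^sup>2"
    using K \<open>0 < c\<close> by (auto simp: k_def divide_le_eq)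
  have contr: "norm (x - \<tau> *\<^sub>R T x) \<le> k * norm x" for x
  proof -
    have "(norm (T x))\<^sup>2 \<le> (K * norm x)\<^sup>2"
      using K norm_blinfun [of T x] by (meson mult_right_mono norm_ge_zero order_trans power_mono)
    then have "\<tau>\<^sup>2 * (norm (T x))\<^sup>2 \<le> \<tau>\<^sup>2 * (K * norm x)\<^sup>2"
      by (simp add: mult_left_mono)
    also have "\<tau>\<^sup>2 * (K * norm x)\<^sup>2 = (c\<^sup>2 / K\<^sup>2) * (norm x)\<^sup>2"
      using K by (simp add: \<tau>_def field_simps power2_eq_square)
    finally have 1: "\<tau>\<^sup>2 * (norm (T x))\<^sup>2 \<le> (c\<^sup>2 / K\<^sup>2) * (norm x)\<^sup>2" .
    have "2 * \<tau> * (c * (norm x)\<^sup>2) \<le> 2 * \<tau> * inner (T x) x"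
      using K \<open>0 < c\<close> by (intro mult_left_mono coercive) (simp add: \<tau>_def)
    moreover have "2 * \<tau> * (c * (norm x)\<^sup>2) = 2 * (c\<^sup>2 / K\<^sup>2) * (norm x)\<^sup>2"
      by (simp add: \<tau>_def power2_eq_square)
    moreover have "(norm (x - \<tau> *\<^sub>R T x))\<^sup>2 = (norm x)\<^sup>2 - 2 * \<tau> * inner (T x) x + \<tau>\<^sup>2 * (norm (T x))\<^sup>2"
      unfolding power2_norm_eq_inner by (simp add: inner_diff inner_commute power2_eq_square)
    ultimately have "(norm (x - \<tau> *\<^sub>R T x))\<^sup>2 \<le> (norm x)\<^sup>2 - (c\<^sup>2 / K\<^sup>2) * (norm x)\<^sup>2"
      using 1 by linarith
    also have "\<dots> = (k * norm x)\<^sup>2"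
      by (simp add: power_mult_distrib k(3) algebra_simps)
    finally show ?thesis
      using k by (simp add: power2_le_iff_abs_le)
  qed
  have "\<tau> \<noteq> 0"
    using K \<open>0 < c\<close> by (simp add: \<tau>_def)
  have ex: "\<exists>x. T x = y" for y
  proof -
    have "dist (x + \<tau> *\<^sub>R (y - T x)) (x' + \<tau> *\<^sub>R (y - T x')) \<le> k * dist x x'" for x x'
      using contr [of "x - x'"]
      by (simp add: dist_norm blinfun.diff_right algebra_simps)
    then obtain x where "x + \<tau> *\<^sub>R (y - T x) = x"
      using banach_fix_type [of k "\<lambda>x. x + \<tau> *\<^sub>R (y - T x)"] k by blast
    then show ?thesis
      using \<open>\<tau> \<noteq> 0\<close> by auto
  qed
  define S where "S y = (SOME x. T x = y)" for y
  have TS: "T (S y) = y" for y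
    unfolding S_def by (rule someI_ex [OF ex])
  have lower: "c * norm x \<le> norm (T x)" for x
  proof (cases "x = 0")
    case False
    have "c * norm x * norm x \<le> norm (T x) * norm x"
      using coercive [of x] norm_cauchy_schwarz [of "T x" x]
      by (simp add: power2_eq_square mult.assoc)
    then show ?thesis
      using False by simp
  qed simp
  have inj: "x = y" if "T x = T y" for x y
    using lower [of "x - y"] that \<open>0 < c\<close> by (simp add: blinfun.diff_right mult_le_0_iff)
  have "bounded_linear S"
  proof (rule bounded_linear_intro)
    show "S (x + y) = S x + S y" for x y
      by (rule inj) (simp add: TS blinfun.add_right)
    show "S (r *\<^sub>R x) = r *\<^sub>R S x" for r x
      by (rule inj) (simp add: TS blinfun.scaleR_right)
    show "norm (S x) \<le> norm x * (1 / c)" for x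
      using lower [of "S x"] \<open>0 < c\<close> by (simp add: TS field_simps)
  qed
  then have B: "blinfun_apply (Blinfun S) = S"
    by (rule bounded_linear_Blinfun_apply)
  have "S (c *\<^sub>C x) = c *\<^sub>C S x" for c x
    by (rule inj) (simp add: TS bounded_opsD [OF T])
  moreover have "S (T x) = x" for x
    by (rule inj) (simp add: TS)
  ultimately show ?thesis
    using TS by (intro bexI [of _ "Blinfun S"]) (auto simp: B bounded_ops_def)
qed

text \<open>For t below a the operator A - tI is coercive, and for t above b the operator tI - A is,
  so either way t is a regular point.\<close>

lemma spectrum_between:
  assumes A: "A \<in> ops_between a b" and t: "complex_of_real t \<in> spectrum A"
  shows "a \<le> t" "t \<le> b"
proof -
  have A': "A \<in> bounded_ops"
    using A by (simp add: ops_between_sa sa_ops_bounded)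
  show "a \<le> t"
  proof (rule ccontr)
    assume "\<not> a \<le> t"
    moreover have "(a - t) * (norm x)\<^sup>2 \<le> inner ((A + (- t) *\<^sub>R id_blinfun) x) x" for x
      using ops_betweenD [OF A, of x]
      by (simp add: blinfun.add_left blinfun.diff_left blinfun.scaleR_left inner_diff_left
          power2_norm_eq_inner algebra_simps)
    ultimately obtain B where "B \<in> bounded_ops"
        "\<forall>x. B ((A + (- t) *\<^sub>R id_blinfun) x) = x \<and> (A + (- t) *\<^sub>R id_blinfun) (B x) = x"
      using coercive_invertible [of "A + (- t) *\<^sub>R id_blinfun" "a - t"] A'
      by (metis bounded_ops_add bounded_ops_scaleR diff_gt_0_iff_gt linorder_not_le
          sa_ops_bounded sa_ops_id)
    then show False
      using t by (auto simp: spectrum_def blinfun.diff_left blinfun.scaleR_left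
          scaleR_scaleC [symmetric])
  qed
  show "t \<le> b"
  proof (rule ccontr)
    assume "\<not> t \<le> b"
    moreover have "(t - b) * (norm x)\<^sup>2 \<le> inner ((t *\<^sub>R id_blinfun + (-1) *\<^sub>R A) x) x" for x
      using ops_betweenD [OF A, of x]
      by (simp add: blinfun.add_left blinfun.scaleR_left blinfun.diff_left inner_diff_left
          power2_norm_eq_inner algebra_simps)
    ultimately obtain B where B: "B \<in> bounded_ops"
        "\<forall>x. B ((t *\<^sub>R id_blinfun + (-1) *\<^sub>R A) x) = x \<and> (t *\<^sub>R id_blinfun + (-1) *\<^sub>R A) (B x) = x"
      using coercive_invertible [of "t *\<^sub>R id_blinfun + (-1) *\<^sub>R A" "t - b"] A'
      by (metis bounded_ops_add bounded_ops_scaleR diff_gt_0_iff_gt linorder_not_le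
          sa_ops_bounded sa_ops_id)
    have "((-1) *\<^sub>R B) (A x - t *\<^sub>R x) = x \<and> A (((-1) *\<^sub>R B) x) - t *\<^sub>R ((-1) *\<^sub>R B) x = x" for x
      using B(2) [rule_format, of x]
      by (simp add: blinfun.diff_left blinfun.minus_left blinfun.scaleR_left blinfun.diff_right
          blinfun.minus_right)
    then show False
      using t B(1) bounded_ops_scaleR [of B "-1"]
      by (auto simp: spectrum_def scaleR_scaleC [symmetric])
  qed
qed

text \<open>Of the inverse only the lower bound is kept; such bounds multiply along linear factors
  in \<open>cpoly_apply_bounded_below\<close>.\<close>

lemma not_spectrum_bounded_below:
  assumes "z \<notin> spectrum A"
  shows "\<exists>c>0. \<forall>x. c * norm x \<le> norm (A x - z *\<^sub>C x)"
proof -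
  obtain B where B: "\<And>x. blinfun_apply B (A x - z *\<^sub>C x) = x"
    using assms by (auto simp: spectrum_def)
  have "norm x \<le> (norm B + 1) * norm (A x - z *\<^sub>C x)" for x
    using norm_blinfun [of B "A x - z *\<^sub>C x"] by (simp add: B distrib_right add_increasing2)
  then have "\<forall>x. 1 / (norm B + 1) * norm x \<le> norm (A x - z *\<^sub>C x)"
    by (simp add: divide_le_eq add_nonneg_pos mult.commute)
  then show ?thesis
    by (intro exI [of _ "1 / (norm B + 1)"]) (simp add: add_nonneg_pos)
qed

text \<open>Since \<open>cinner (A x) x\<close> is real, the form of A - z has imaginary part of
  modulus |Im z| |x|^2, and Cauchy-Schwarz bounds this by the norm of (A - z)x times |x|.\<close>

lemma sa_nonreal_bounded_below:
  assumes "A \<in> sa_ops" "Im z \<noteq> 0"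
  shows "\<exists>c>0. \<forall>x. c * norm x \<le> norm (A x - z *\<^sub>C x)"
proof (intro exI conjI allI)
  fix x
  have "Im (cinner (A x) x) = 0"
    using sa_ops_cinner [OF assms(1), of x x] cinner_commute [of "A x" x]
    by (metis Im_complex_of_real Reals_cnj_iff complex_is_Real_iff)
  then have "\<bar>Im z\<bar> * (norm x)\<^sup>2 = \<bar>Im (cinner (A x - z *\<^sub>C x) x)\<bar>"
    by (simp add: cinner_diff_left cinner_scaleC_left cinner_self abs_mult)
  also have "\<dots> \<le> norm (A x - z *\<^sub>C x) * norm x"
    by (meson abs_Im_le_cmod cinner_Cauchy_Schwarz order_trans)
  finally have "\<bar>Im z\<bar> * norm x * norm x \<le> norm (A x - z *\<^sub>C x) * norm x"
    by (simp add: power2_eq_square mult.assoc)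
  then show "\<bar>Im z\<bar> * norm x \<le> norm (A x - z *\<^sub>C x)"
    by (cases "x = 0") auto
qed (use assms(2) in simp)

section \<open>Polynomials in an operator and their norms\<close>

lemma poly_op_altdef:
  assumes "degree p \<le> n"
  shows "poly_op p A = (\<Sum>i\<le>n. coeff p i *\<^sub>R (((o\<^sub>L) A ^^ i) id_blinfun))"
  unfolding poly_op_def using assms
  by (intro sum.mono_neutral_left) (auto simp: coeff_eq_0)

lemma poly_op_0 [simp]: "poly_op 0 A = 0"
  by (simp add: poly_op_def)

lemma poly_op_pCons: "poly_op (pCons a p) A = a *\<^sub>R id_blinfun + (A o\<^sub>L poly_op p A)"
proof -
  have "poly_op (pCons a p) A
      = (\<Sum>i\<le>Suc (degree p). coeff (pCons a p) i *\<^sub>R (((o\<^sub>L) A ^^ i) id_blinfun))"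
    by (rule poly_op_altdef) (rule degree_pCons_le)
  also have "\<dots> = a *\<^sub>R id_blinfun + (\<Sum>i\<le>degree p. coeff p i *\<^sub>R (A o\<^sub>L ((o\<^sub>L) A ^^ i) id_blinfun))"
    by (simp add: sum.atMost_Suc_shift del: sum.atMost_Suc)
  also have "(\<Sum>i\<le>degree p. coeff p i *\<^sub>R (A o\<^sub>L ((o\<^sub>L) A ^^ i) id_blinfun)) = A o\<^sub>L poly_op p A"
    by (simp add: poly_op_def bounded_bilinear.sum_right [OF bounded_bilinear_blinfun_compose]
        bounded_bilinear.scaleR_right [OF bounded_bilinear_blinfun_compose])
  finally show ?thesis .
qed

lemma poly_op_add: "poly_op (p + q) A = poly_op p A + poly_op q A"
  by (induction p q rule: poly_induct2)
    (simp_all add: poly_op_pCons scaleR_add_left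
      bounded_bilinear.add_right [OF bounded_bilinear_blinfun_compose])

lemma poly_op_smult: "poly_op (smult c p) A = c *\<^sub>R poly_op p A"
  by (induction p) (simp_all add: poly_op_pCons scaleR_add_right
      bounded_bilinear.scaleR_right [OF bounded_bilinear_blinfun_compose])

lemma poly_op_diff: "poly_op (p - q) A = poly_op p A - poly_op q A"
  using poly_op_add [of p "smult (-1) q" A] poly_op_smult [of "-1" q A] by simp

lemma poly_op_mult: "poly_op (p * q) A = poly_op p A o\<^sub>L poly_op q A"
proof (induction p)
  case (pCons a p)
  show ?case
    by (rule blinfun_eqI)
      (simp add: pCons.IH mult_pCons_left poly_op_add poly_op_smult poly_op_pCons
        blinfun.add_left blinfun.scaleR_left)
qed simp

lemma poly_op_sa: "A \<in> sa_ops \<Longrightarrow> poly_op p A \<in> sa_ops"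
proof (induction p)
  case 0
  then show ?case
    using sa_ops_scaleR [OF sa_ops_id, of 0] by simp
next
  case (pCons a p)
  \<comment> \<open>Writing A itself as a polynomial in A derives commutation from commutativity of
    polynomial multiplication.\<close>
  have A: "A = poly_op [:0, 1:] A"
    by (simp add: poly_op_pCons) (rule blinfun_eqI, simp)
  have "A o\<^sub>L poly_op p A = poly_op p A o\<^sub>L A"
    by (metis A mult.commute poly_op_mult)
  then show ?case
    using pCons by (simp add: poly_op_pCons sa_ops_add sa_ops_scaleR sa_ops_id sa_ops_compose)
qed

text \<open>Horner evaluation of Q(A)x. Splitting off complex roots requires complex coefficients,
  and these act on vectors through \<open>scaleC\<close>, whereas \<open>poly_op\<close> forms real
  combinations of operators.\<close>

definition cpoly_apply :: "('a::complex_hilbert_space \<Rightarrow>\<^sub>L 'a) \<Rightarrow> 'a \<Rightarrow> complex poly \<Rightarrow> 'a" where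
  "cpoly_apply A x Q = fold_coeffs (\<lambda>a y. a *\<^sub>C x + A y) Q 0"

lemma cpoly_apply_0 [simp]: "cpoly_apply A x 0 = 0"
  by (simp add: cpoly_apply_def)

lemma cpoly_apply_pCons: "cpoly_apply A x (pCons a Q) = a *\<^sub>C x + A (cpoly_apply A x Q)"
  by (cases "a = 0 \<and> Q = 0") (auto simp: cpoly_apply_def)

lemma cpoly_apply_add: "cpoly_apply A x (P + Q) = cpoly_apply A x P + cpoly_apply A x Q"
  by (induction P Q rule: poly_induct2)
    (simp_all add: cpoly_apply_pCons scaleC_add_left blinfun.add_right)

lemma cpoly_apply_smult:
  "A \<in> bounded_ops \<Longrightarrow> cpoly_apply A x (smult c Q) = c *\<^sub>C cpoly_apply A x Q"
  by (induction Q) (simp_all add: cpoly_apply_pCons scaleC_add_right scaleC_scaleC bounded_opsD)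

lemma cpoly_apply_of_real: "cpoly_apply A x (map_poly complex_of_real q) = poly_op q A x"
  by (induction q) (simp_all add: cpoly_apply_pCons poly_op_pCons map_poly_pCons
      blinfun.add_left blinfun.scaleR_left scaleR_scaleC)

lemma poly_map_complex_of_real:
  "poly (map_poly complex_of_real p) (complex_of_real t) = complex_of_real (poly p t)"
  by (induction p) (simp_all add: map_poly_pCons)

text \<open>By the fundamental theorem of algebra Q splits into linear factors; each factor A - z at
  a root is bounded below, hence so is their composition.\<close>

lemma cpoly_apply_bounded_below:
  fixes A :: "'a::complex_hilbert_space \<Rightarrow>\<^sub>L 'a"
  assumes "A \<in> bounded_ops" "Q \<noteq> 0"
    and "\<And>z. poly Q z = 0 \<Longrightarrow> \<exists>c>0. \<forall>x. c * norm x \<le> norm (A x - z *\<^sub>C x)"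
  shows "\<exists>c>0. \<forall>x. c * norm x \<le> norm (cpoly_apply A x Q)"
  using assms(2,3)
proof (induction "degree Q" arbitrary: Q)
  case 0
  then obtain a where "Q = [:a:]" "a \<noteq> 0"
    by (metis degree_eq_zeroE pCons_0_0)
  then show ?case
    by (intro exI [of _ "cmod a"]) (simp add: cpoly_apply_pCons norm_scaleC)
next
  case (Suc n)
  then have "\<not> constant (poly Q)"
    by (simp add: constant_degree)
  then obtain z where "poly Q z = 0"
    using fundamental_theorem_of_algebra by blast
  then obtain R where Q: "Q = [:- z, 1:] * R"
    by (metis dvdE poly_eq_0_iff_dvd)
  have "R \<noteq> 0"
    using Suc.prems(1) Q by auto
  then have "degree R = n"
    using Suc.hyps(2) by (simp add: Q degree_mult_eq del: mult_pCons_left)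
  then obtain c where c: "c > 0" "\<And>x. c * norm x \<le> norm (cpoly_apply A x R)"
    using Suc.hyps(1) [of R] \<open>R \<noteq> 0\<close> Suc.prems(2) by (auto simp: Q simp del: mult_pCons_left)
  obtain d where d: "d > 0" "\<And>x. d * norm x \<le> norm (A x - z *\<^sub>C x)"
    using Suc.prems(2) [OF \<open>poly Q z = 0\<close>] by blast
  have eq: "cpoly_apply A x Q = A (cpoly_apply A x R) - z *\<^sub>C cpoly_apply A x R" for x
    using assms(1) by (simp add: Q mult_pCons_left cpoly_apply_add cpoly_apply_smult
        cpoly_apply_pCons del: smult_minus_left)
  have "d * c * norm x \<le> norm (cpoly_apply A x Q)" for x
  proof -
    have "d * (c * norm x) \<le> d * norm (cpoly_apply A x R)"
      using d(1) by (intro mult_left_mono c(2)) simp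
    also have "\<dots> \<le> norm (cpoly_apply A x Q)"
      unfolding eq by (rule d(2))
    finally show ?thesis
      by (simp add: mult.assoc)
  qed
  then show ?case
    using c(1) d(1) by (intro exI [of _ "d * c"]) simp
qed

text \<open>
  If \<open>M = \<parallel>S\<parallel>\<close> with \<open>S = q(A)\<close>, then \<open>S\<^sup>2 - M\<^sup>2\<close> is not bounded below, so \<open>A - z\<close> is not bounded
  below for some complex root \<open>z\<close> of \<open>q\<^sup>2 - M\<^sup>2\<close>, and such a \<open>z\<close> is real.
\<close>

lemma norm_poly_op_attained:
  fixes A :: "'a::complex_hilbert_space \<Rightarrow>\<^sub>L 'a" and x\<^sub>0 :: 'a
  assumes A: "A \<in> sa_ops" and "x\<^sub>0 \<noteq> 0" and nz: "q * q \<noteq> [:(norm (poly_op q A))\<^sup>2:]"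
  shows "\<exists>t. complex_of_real t \<in> spectrum A \<and> \<bar>poly q t\<bar> = norm (poly_op q A)"
proof (rule ccontr)
  assume none: "\<not> ?thesis"
  define S where "S = poly_op q A"
  define M where "M = norm S"
  define Q where "Q = map_poly complex_of_real (q * q - [:M\<^sup>2:])"
  have S: "S \<in> sa_ops"
    unfolding S_def using A by (rule poly_op_sa)
  have "Q \<noteq> 0"
    using nz by (simp add: Q_def M_def S_def map_poly_eq_0_iff)
  moreover have "\<exists>c>0. \<forall>x. c * norm x \<le> norm (A x - z *\<^sub>C x)" if "poly Q z = 0" for z
  proof (cases "Im z = 0")
    case True
    then obtain t where t: "z = complex_of_real t"
      by (metis complex_is_Real_iff Reals_cases)
    then have "poly Q z = complex_of_real ((poly q t)\<^sup>2 - M\<^sup>2)"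
      by (simp add: Q_def poly_map_complex_of_real power2_eq_square)
    with that have "(poly q t)\<^sup>2 = M\<^sup>2"
      by (metis eq_iff_diff_eq_0 of_real_eq_0_iff)
    then have "\<bar>poly q t\<bar> = M"
      by (metis M_def abs_norm_cancel real_sqrt_abs)
    then show ?thesis
      using none t not_spectrum_bounded_below by (auto simp: M_def S_def)
  qed (use A sa_nonreal_bounded_below in blast)
  ultimately obtain c where "c > 0" and c: "\<And>x. c * norm x \<le> norm (cpoly_apply A x Q)"
    using cpoly_apply_bounded_below sa_ops_bounded [OF A] by blast
  have "cpoly_apply A x Q = S (S x) - M\<^sup>2 *\<^sub>R x" for x
    unfolding Q_def cpoly_apply_of_real poly_op_diff poly_op_mult
    by (simp add: S_def blinfun.diff_left poly_op_pCons blinfun.scaleR_left)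
  then have "c * norm x \<le> norm (S (S x) - M\<^sup>2 *\<^sub>R x)" for x
    using c by simp
  then have 1: "c\<^sup>2 * (norm x)\<^sup>2 \<le> (norm (S (S x) - M\<^sup>2 *\<^sub>R x))\<^sup>2" for x
    unfolding power_mult_distrib [symmetric] using \<open>c > 0\<close> by (intro power_mono) auto
  have 2: "(norm (S (S x) - M\<^sup>2 *\<^sub>R x))\<^sup>2
      = (norm (S (S x)))\<^sup>2 - 2 * M\<^sup>2 * (norm (S x))\<^sup>2 + M\<^sup>2 * M\<^sup>2 * (norm x)\<^sup>2" for x
    using sa_opsD [OF S, of "S x" x]
    by (simp add: power2_norm_eq_inner inner_diff inner_commute)
  have 3: "(norm (S (S x)))\<^sup>2 \<le> M\<^sup>2 * (norm (S x))\<^sup>2" for x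
    unfolding M_def power_mult_distrib [symmetric] by (intro power_mono norm_blinfun) auto
  \<comment> \<open>Insert 3 into the expansion 2 and compare with 1. For nonzero M this gives
    |Sx|^2 <= (M^2 - c^2/M^2) |x|^2, which contradicts M being the norm of S.\<close>
  have *: "c\<^sup>2 * (norm x)\<^sup>2 \<le> M\<^sup>2 * (M\<^sup>2 * (norm x)\<^sup>2) - M\<^sup>2 * (norm (S x))\<^sup>2" for x
    using 1 [of x] 2 [of x] 3 [of x] by (simp add: mult.assoc)
  show False
  proof (cases "M = 0")
    case True
    then show ?thesis
      using * [of x\<^sub>0] \<open>x\<^sub>0 \<noteq> 0\<close> \<open>c > 0\<close> by (simp add: mult_le_0_iff)
  next
    case False
    then have "M > 0"
      by (simp add: M_def)
    define k where "k = M\<^sup>2 - c\<^sup>2 / M\<^sup>2"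
    have k: "(norm (S x))\<^sup>2 \<le> k * (norm x)\<^sup>2" for x
    proof -
      have "M\<^sup>2 * k = M\<^sup>2 * M\<^sup>2 - c\<^sup>2"
        using \<open>M > 0\<close> by (simp add: k_def right_diff_distrib)
      then have "M\<^sup>2 * (k * (norm x)\<^sup>2) = (M\<^sup>2 * M\<^sup>2 - c\<^sup>2) * (norm x)\<^sup>2"
        by (metis mult.assoc)
      then have "M\<^sup>2 * (norm (S x))\<^sup>2 \<le> M\<^sup>2 * (k * (norm x)\<^sup>2)"
        using * [of x] by (simp add: algebra_simps)
      then show ?thesis
        using \<open>M > 0\<close> by simp
    qed
    have "0 \<le> k * (norm x\<^sub>0)\<^sup>2"
      using k [of x\<^sub>0] zero_le_power2 order_trans by blast
    then have "0 \<le> k"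
      using \<open>x\<^sub>0 \<noteq> 0\<close> by (simp add: zero_le_mult_iff)
    have "norm (S x) \<le> sqrt k * norm x" for x
      using real_sqrt_le_mono [OF k [of x]] by (simp add: real_sqrt_mult)
    then have "M \<le> sqrt k"
      unfolding M_def using \<open>0 \<le> k\<close> by (intro norm_blinfun_bound) auto
    then have "M\<^sup>2 \<le> k"
      using \<open>0 \<le> k\<close> \<open>M > 0\<close> by (metis less_imp_le power_mono real_sqrt_pow2)
    then show ?thesis
      using \<open>c > 0\<close> \<open>M > 0\<close> by (simp add: k_def divide_le_0_iff)
  qed
qed

text \<open>In general the norm of q(A) is a value of |q| on the spectrum by
  \<open>norm_poly_op_attained\<close>. Two cases remain: q^2 constant, and the zero space, where
  every operator vanishes.\<close>

lemma norm_poly_op_le: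
  fixes A :: "'a::complex_hilbert_space \<Rightarrow>\<^sub>L 'a"
  assumes A: "A \<in> sa_ops" and "0 \<le> e"
    and le: "\<And>t. complex_of_real t \<in> spectrum A \<Longrightarrow> \<bar>poly q t\<bar> \<le> e"
  shows "norm (poly_op q A) \<le> e"
proof (cases "\<exists>x::'a. x \<noteq> 0")
  case True
  then obtain x\<^sub>0 :: 'a where x0: "x\<^sub>0 \<noteq> 0"
    by blast
  show ?thesis
  proof (cases "q * q = [:(norm (poly_op q A))\<^sup>2:]")
    case False
    then show ?thesis
      using norm_poly_op_attained [OF A x0] le by metis
  next
    case True
    \<comment> \<open>If q^2 is the constant M^2, then |q| = M at every point, so any real point of
      the spectrum will do. One is found by applying the attainment lemma to the nonconstant
      polynomial for A itself.\<close>
    have "[:0, 1:] * [:0, 1:] \<noteq> [:(norm (poly_op [:0, 1:] A))\<^sup>2:]"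
      by simp
    then obtain t where t: "complex_of_real t \<in> spectrum A"
      using norm_poly_op_attained [OF A x0] by blast
    have "(poly q t)\<^sup>2 = (norm (poly_op q A))\<^sup>2"
      using arg_cong [OF True, of "\<lambda>r. poly r t"] by (simp add: power2_eq_square)
    then have "norm (poly_op q A) = \<bar>poly q t\<bar>"
      by (metis abs_norm_cancel power2_eq_iff abs_minus)
    then show ?thesis
      using le [OF t] by simp
  qed
next
  case False
  then have "poly_op q A = 0"
    by (intro blinfun_eqI) metis
  then show ?thesis
    using \<open>0 \<le> e\<close> by simp
qed

subsection \<open>Continuous functional calculus\<close>

lemma ex_poly_approx:
  fixes f :: "real \<Rightarrow> real"
  assumes "continuous_on {a..b} f" "0 < e"
  shows "\<exists>p. \<forall>t\<in>{a..b}. \<bar>poly p t - f t\<bar> < e"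
proof -
  obtain g where g: "real_polynomial_function g" "\<And>t. t \<in> {a..b} \<Longrightarrow> \<bar>f t - g t\<bar> < e"
    using Stone_Weierstrass_real_polynomial_function [OF _ assms] by auto
  obtain c n where "g = (\<lambda>t. \<Sum>i\<le>n. c i * t ^ i)"
    using g(1) by (auto simp: real_polynomial_function_iff_sum)
  then have "poly (\<Sum>i\<le>n. monom (c i) i) = g"
    by (simp add: fun_eq_iff poly_sum poly_monom)
  then show ?thesis
    using g(2) by (metis abs_minus_commute)
qed

lemma ex_poly_uniform_limit:
  fixes f :: "real \<Rightarrow> real"
  assumes "continuous_on {a..b} f"
  obtains p where "uniform_limit {a..b} (\<lambda>n. poly (p n)) f sequentially"
proof -
  have "\<exists>p. \<forall>t\<in>{a..b}. \<bar>poly p t - f t\<bar> < inverse (real (Suc n))" for n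
    by (rule ex_poly_approx [OF assms]) simp
  then obtain p where p: "\<And>n t. t \<in> {a..b} \<Longrightarrow> \<bar>poly (p n) t - f t\<bar> < inverse (real (Suc n))"
    by metis
  have "uniform_limit {a..b} (\<lambda>n. poly (p n)) f sequentially"
  proof (rule uniform_limitI)
    fix e :: real
    assume "0 < e"
    with LIMSEQ_inverse_real_of_nat have "\<forall>\<^sub>F n in sequentially. inverse (real (Suc n)) < e"
      by (rule order_tendstoD)
    then show "\<forall>\<^sub>F n in sequentially. \<forall>t\<in>{a..b}. dist (poly (p n) t) (f t) < e"
      by eventually_elim (use p in \<open>force simp: dist_real_def intro: less_trans\<close>)
  qed
  then show ?thesis
    by (rule that)
qed

lemma poly_op_dist_le:
  assumes "A \<in> sa_ops" "0 \<le> e"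
    and "\<And>t. complex_of_real t \<in> spectrum A \<Longrightarrow> \<bar>poly p t - poly q t\<bar> \<le> e"
  shows "dist (poly_op p A) (poly_op q A) \<le> e"
  unfolding dist_norm poly_op_diff [symmetric] using assms by (intro norm_poly_op_le) auto

lemma fun_calc_tendsto_spectrum:
  fixes A :: "'a::complex_hilbert_space \<Rightarrow>\<^sub>L 'a"
  assumes A: "A \<in> ops_between a b" and f: "continuous_on {a..b} f"
    and p: "uniform_limit {t. complex_of_real t \<in> spectrum A} (\<lambda>n. poly (p n)) f sequentially"
  shows "(\<lambda>n. poly_op (p n) A) \<longlonglongrightarrow> fun_calc f A"
proof -
  let ?\<sigma> = "{t. complex_of_real t \<in> spectrum A}"
  have sa: "A \<in> sa_ops"
    using A by (rule ops_between_sa)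
  \<comment> \<open>Two sequences are compared at once: equal sequences give the Cauchy property,
    different ones give independence of the limit from the sequence, as the definite description in
    \<open>fun_calc\<close> demands.\<close>
  have near: "\<exists>N. \<forall>m\<ge>N. \<forall>n\<ge>N. dist (poly_op (q m) A) (poly_op (r n) A) < e"
    if q: "uniform_limit ?\<sigma> (\<lambda>n. poly (q n)) f sequentially"
      and r: "uniform_limit ?\<sigma> (\<lambda>n. poly (r n)) f sequentially" and "0 < e" for q r e
  proof -
    have "0 < e / 4"
      using \<open>0 < e\<close> by simp
    then have "\<forall>\<^sub>F n in sequentially. (\<forall>t\<in>?\<sigma>. dist (poly (q n) t) (f t) < e / 4) \<and>
        (\<forall>t\<in>?\<sigma>. dist (poly (r n) t) (f t) < e / 4)"
      by (intro eventually_conj uniform_limitD [OF q] uniform_limitD [OF r])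
    then obtain N where N: "\<And>n t. n \<ge> N \<Longrightarrow> t \<in> ?\<sigma> \<Longrightarrow> \<bar>poly (q n) t - f t\<bar> < e / 4"
        "\<And>n t. n \<ge> N \<Longrightarrow> t \<in> ?\<sigma> \<Longrightarrow> \<bar>poly (r n) t - f t\<bar> < e / 4"
      unfolding eventually_sequentially dist_real_def by blast
    have "dist (poly_op (q m) A) (poly_op (r n) A) \<le> e / 2" if "m \<ge> N" "n \<ge> N" for m n
    proof (rule poly_op_dist_le [OF sa])
      fix t
      assume "complex_of_real t \<in> spectrum A"
      then have "t \<in> ?\<sigma>"
        by simp
      then show "\<bar>poly (q m) t - poly (r n) t\<bar> \<le> e / 2"
        using N(1) [OF that(1) \<open>t \<in> ?\<sigma>\<close>] N(2) [OF that(2) \<open>t \<in> ?\<sigma>\<close>] by linarith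
    qed (use \<open>0 < e\<close> in simp)
    then show ?thesis
      using \<open>0 < e\<close> by (intro exI [of _ N]) force
  qed
  obtain r where "uniform_limit {a..b} (\<lambda>n. poly (r n)) f sequentially"
    using ex_poly_uniform_limit [OF f] .
  then have r: "uniform_limit ?\<sigma> (\<lambda>n. poly (r n)) f sequentially"
    by (rule uniform_limit_on_subset) (use spectrum_between [OF A] in auto)
  have "Cauchy (\<lambda>n. poly_op (r n) A)"
    unfolding Cauchy_def using near [OF r r] by blast
  then obtain L where L: "(\<lambda>n. poly_op (r n) A) \<longlonglongrightarrow> L"
    using Cauchy_convergent convergent_def by blast
  have lim: "(\<lambda>n. poly_op (q n) A) \<longlonglongrightarrow> L"
    if q: "uniform_limit ?\<sigma> (\<lambda>n. poly (q n)) f sequentially" for q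
  proof -
    have "(\<lambda>n. poly_op (q n) A - poly_op (r n) A) \<longlonglongrightarrow> 0"
    proof (rule LIMSEQ_I)
      fix e :: real
      assume "0 < e"
      then show "\<exists>N. \<forall>n\<ge>N. norm (poly_op (q n) A - poly_op (r n) A - 0) < e"
        using near [OF q r, of e] unfolding dist_norm diff_zero by blast
    qed
    from tendsto_add [OF this L] show ?thesis
      by simp
  qed
  have "fun_calc f A = L"
    unfolding fun_calc_def
  proof (rule the_equality)
    fix T
    assume "\<forall>p. uniform_limit ?\<sigma> (\<lambda>n. poly (p n)) f sequentially \<longrightarrow> (\<lambda>n. poly_op (p n) A) \<longlonglongrightarrow> T"
    then show "T = L"
      using r L LIMSEQ_unique by blast
  qed (use lim in blast)
  then show ?thesis
    using lim [OF p] by simp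
qed

lemma fun_calc_tendsto:
  assumes "A \<in> ops_between a b" "continuous_on {a..b} f"
    and "uniform_limit {a..b} (\<lambda>n. poly (p n)) f sequentially"
  shows "(\<lambda>n. poly_op (p n) A) \<longlonglongrightarrow> fun_calc f A"
  by (intro fun_calc_tendsto_spectrum [OF assms(1,2)] uniform_limit_on_subset [OF assms(3)])
    (use spectrum_between [OF assms(1)] in auto)

lemma norm_fun_calc_le:
  assumes A: "A \<in> ops_between a b" and f: "continuous_on {a..b} f"
    and "0 \<le> e" and le: "\<And>t. t \<in> {a..b} \<Longrightarrow> \<bar>f t\<bar> \<le> e"
  shows "norm (fun_calc f A) \<le> e"
proof (rule field_le_epsilon)
  fix d :: real
  assume "0 < d"
  obtain p where p: "uniform_limit {a..b} (\<lambda>n. poly (p n)) f sequentially"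
    using ex_poly_uniform_limit [OF f] .
  have "\<forall>\<^sub>F n in sequentially. norm (poly_op (p n) A) \<le> e + d"
    using uniform_limitD [OF p \<open>0 < d\<close>]
  proof eventually_elim
    case (elim n)
    show ?case
    proof (rule norm_poly_op_le [OF ops_between_sa [OF A]])
      fix t
      assume "complex_of_real t \<in> spectrum A"
      then have "t \<in> {a..b}"
        using spectrum_between [OF A] by simp
      then show "\<bar>poly (p n) t\<bar> \<le> e + d"
        using elim le [of t] by (force simp: dist_real_def)
    qed (use \<open>0 < d\<close> \<open>0 \<le> e\<close> in simp)
  qed
  then show "norm (fun_calc f A) \<le> e + d"
    using tendsto_norm [OF fun_calc_tendsto [OF A f p]] tendsto_upperbound
      trivial_limit_sequentially by blast
qed

lemma fun_calc_poly:
  assumes "A \<in> ops_between a b"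
  shows "fun_calc (poly q) A = poly_op q A"
proof -
  have "(\<lambda>n. poly_op q A) \<longlonglongrightarrow> fun_calc (poly q) A"
    by (rule fun_calc_tendsto [OF assms])
      (auto intro: continuous_intros uniform_limit_const)
  then show ?thesis
    by (simp add: LIMSEQ_const_iff)
qed

lemma fun_calc_id:
  assumes "A \<in> ops_between a b"
  shows "fun_calc (\<lambda>t. t) A = A"
proof -
  have "(\<lambda>t. t) = poly [:0, 1 :: real:]"
    by auto
  then show ?thesis
    using fun_calc_poly [OF assms, of "[:0, 1:]"]
    by (simp add: poly_op_pCons) (auto intro!: blinfun_eqI)
qed

lemma fun_calc_const:
  assumes "A \<in> ops_between a b"
  shows "fun_calc (\<lambda>t. c) A = c *\<^sub>R id_blinfun"
proof -
  have "(\<lambda>t. c) = poly [:c:]"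
    by auto
  then show ?thesis
    using fun_calc_poly [OF assms, of "[:c:]"] by (simp add: poly_op_pCons)
qed

lemma fun_calc_cong:
  assumes A: "A \<in> ops_between a b" and f: "continuous_on {a..b} f"
    and eq: "\<And>t. t \<in> {a..b} \<Longrightarrow> f t = g t"
  shows "fun_calc f A = fun_calc g A"
proof -
  obtain p where p: "uniform_limit {a..b} (\<lambda>n. poly (p n)) f sequentially"
    using ex_poly_uniform_limit [OF f] .
  have g: "continuous_on {a..b} g"
    using f eq by (metis continuous_on_cong)
  have "uniform_limit {a..b} (\<lambda>n. poly (p n)) g sequentially"
    by (subst uniform_limit_cong' [where g = "\<lambda>n. poly (p n)" and i = f]) (simp_all add: p eq)
  then show ?thesis
    using fun_calc_tendsto [OF A f p] fun_calc_tendsto [OF A g] LIMSEQ_unique by blast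
qed

lemma fun_calc_sa:
  assumes A: "A \<in> ops_between a b" and f: "continuous_on {a..b} f"
  shows "fun_calc f A \<in> sa_ops"
proof -
  obtain p where p: "uniform_limit {a..b} (\<lambda>n. poly (p n)) f sequentially"
    using ex_poly_uniform_limit [OF f] .
  show ?thesis
    by (rule closed_sequentially [OF closed_sa_ops _ fun_calc_tendsto [OF A f p]])
      (intro poly_op_sa ops_between_sa [OF A])
qed

lemma fun_calc_add:
  assumes A: "A \<in> ops_between a b" and f: "continuous_on {a..b} f" and g: "continuous_on {a..b} g"
  shows "fun_calc (\<lambda>t. f t + g t) A = fun_calc f A + fun_calc g A"
proof -
  obtain p q where p: "uniform_limit {a..b} (\<lambda>n. poly (p n)) f sequentially"
      and q: "uniform_limit {a..b} (\<lambda>n. poly (q n)) g sequentially"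
    using ex_poly_uniform_limit f g by metis
  have "uniform_limit {a..b} (\<lambda>n. poly (p n + q n)) (\<lambda>t. f t + g t) sequentially"
    using uniform_limit_add [OF p q] by (simp add: poly_add [abs_def])
  then have "(\<lambda>n. poly_op (p n) A + poly_op (q n) A) \<longlonglongrightarrow> fun_calc (\<lambda>t. f t + g t) A"
    unfolding poly_op_add [symmetric] by (rule fun_calc_tendsto [OF A continuous_on_add [OF f g]])
  moreover have "(\<lambda>n. poly_op (p n) A + poly_op (q n) A) \<longlonglongrightarrow> fun_calc f A + fun_calc g A"
    by (intro tendsto_add fun_calc_tendsto [OF A f p] fun_calc_tendsto [OF A g q])
  ultimately show ?thesis
    by (rule LIMSEQ_unique)
qed

lemma fun_calc_mult:
  assumes A: "A \<in> ops_between a b" and f: "continuous_on {a..b} f" and g: "continuous_on {a..b} g"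
  shows "fun_calc (\<lambda>t. f t * g t) A = fun_calc f A o\<^sub>L fun_calc g A"
proof -
  obtain p q where p: "uniform_limit {a..b} (\<lambda>n. poly (p n)) f sequentially"
      and q: "uniform_limit {a..b} (\<lambda>n. poly (q n)) g sequentially"
    using ex_poly_uniform_limit f g by metis
  have "bounded (f ` {a..b})" "bounded (g ` {a..b})"
    using f g by (auto intro: compact_imp_bounded compact_continuous_image)
  then have "uniform_limit {a..b} (\<lambda>n. poly (p n * q n)) (\<lambda>t. f t * g t) sequentially"
    using uniform_lim_mult [OF p q] by (simp add: poly_mult [abs_def])
  then have "(\<lambda>n. poly_op (p n) A o\<^sub>L poly_op (q n) A) \<longlonglongrightarrow> fun_calc (\<lambda>t. f t * g t) A"
    unfolding poly_op_mult [symmetric] by (rule fun_calc_tendsto [OF A continuous_on_mult [OF f g]])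
  moreover have "(\<lambda>n. poly_op (p n) A o\<^sub>L poly_op (q n) A) \<longlonglongrightarrow> (fun_calc f A o\<^sub>L fun_calc g A)"
    by (intro bounded_bilinear.tendsto [OF bounded_bilinear_blinfun_compose]
        fun_calc_tendsto [OF A f p] fun_calc_tendsto [OF A g q])
  ultimately show ?thesis
    by (rule LIMSEQ_unique)
qed

lemma fun_calc_scaleR:
  assumes A: "A \<in> ops_between a b" and f: "continuous_on {a..b} f"
  shows "fun_calc (\<lambda>t. c * f t) A = c *\<^sub>R fun_calc f A"
  unfolding fun_calc_mult [OF A continuous_on_const f] fun_calc_const [OF A]
  by (rule blinfun_eqI) (simp add: blinfun.scaleR_left)

lemma fun_calc_diff:
  assumes A: "A \<in> ops_between a b" and f: "continuous_on {a..b} f" and g: "continuous_on {a..b} g"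
  shows "fun_calc (\<lambda>t. f t - g t) A = fun_calc f A - fun_calc g A"
  using fun_calc_add [OF A f continuous_on_mult_left [OF g, of "-1"]]
    fun_calc_scaleR [OF A g, of "-1"] by simp

text \<open>With S = (sqrt f)(A) self-adjoint, f(A) = SS, so the form of f(A) at x is the squared
  norm of Sx.\<close>

lemma fun_calc_nonneg:
  assumes A: "A \<in> ops_between a b" and f: "continuous_on {a..b} f"
    and "\<And>t. t \<in> {a..b} \<Longrightarrow> 0 \<le> f t"
  shows "0 \<le> inner (fun_calc f A x) x"
proof -
  have s: "continuous_on {a..b} (\<lambda>t. sqrt (f t))"
    using f by (intro continuous_intros)
  let ?S = "fun_calc (\<lambda>t. sqrt (f t)) A"
  have "fun_calc f A = fun_calc (\<lambda>t. sqrt (f t) * sqrt (f t)) A"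
    using assms(3) by (intro fun_calc_cong [OF A f]) simp
  then have "fun_calc f A = ?S o\<^sub>L ?S"
    by (simp only: fun_calc_mult [OF A s s])
  then have "inner (fun_calc f A x) x = inner (?S x) (?S x)"
    using sa_opsD [OF fun_calc_sa [OF A s], of "?S x" x] by simp
  then show ?thesis
    by simp
qed

lemma fun_calc_between:
  assumes A: "A \<in> ops_between a b" and f: "continuous_on {a..b} f"
    and le: "\<And>t. t \<in> {a..b} \<Longrightarrow> c \<le> f t \<and> f t \<le> d"
  shows "fun_calc f A \<in> ops_between c d"
proof -
  have "0 \<le> inner (fun_calc (\<lambda>t. f t - c) A x) x" "0 \<le> inner (fun_calc (\<lambda>t. d - f t) A x) x" for x
    using le f by (auto intro!: fun_calc_nonneg [OF A] continuous_intros)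
  then show ?thesis
    using fun_calc_sa [OF A f]
    by (simp add: fun_calc_diff [OF A f continuous_on_const]
        fun_calc_diff [OF A continuous_on_const f] fun_calc_const [OF A] ops_between_def
        blinfun.diff_left blinfun.scaleR_left inner_diff_left power2_norm_eq_inner)
qed

lemma fun_calc_poly_compose:
  assumes A: "A \<in> ops_between a b" and f: "continuous_on {a..b} f"
  shows "fun_calc (\<lambda>t. poly q (f t)) A = poly_op q (fun_calc f A)"
proof (induction q)
  case 0
  then show ?case
    using fun_calc_const [OF A, of 0] by simp
next
  case (pCons c q)
  have q: "continuous_on {a..b} (\<lambda>t. poly q (f t))"
    using f by (intro continuous_intros)
  have "fun_calc (\<lambda>t. c + f t * poly q (f t)) A
      = c *\<^sub>R id_blinfun + (fun_calc f A o\<^sub>L fun_calc (\<lambda>t. poly q (f t)) A)"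
    unfolding fun_calc_add [OF A continuous_on_const continuous_on_mult [OF f q]]
      fun_calc_const [OF A] fun_calc_mult [OF A f q] ..
  then show ?case
    by (simp add: poly_op_pCons pCons.IH)
qed

text \<open>The polynomial case is \<open>fun_calc_poly_compose\<close>. Polynomials approximating g
  on [c,d], composed with f, approximate the composite uniformly on [a,b], and
  \<open>norm_fun_calc_le\<close> transfers this to operators.\<close>

lemma fun_calc_compose:
  assumes A: "A \<in> ops_between a b" and f: "continuous_on {a..b} f"
    and g: "continuous_on {c..d} g" and le: "\<And>t. t \<in> {a..b} \<Longrightarrow> c \<le> f t \<and> f t \<le> d"
  shows "fun_calc g (fun_calc f A) = fun_calc (\<lambda>t. g (f t)) A"
proof -
  obtain p where p: "uniform_limit {c..d} (\<lambda>n. poly (p n)) g sequentially"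
    using ex_poly_uniform_limit [OF g] .
  have gf: "continuous_on {a..b} (\<lambda>t. g (f t))"
    by (rule continuous_on_compose2 [OF g f]) (use le in auto)
  have pf: "continuous_on {a..b} (\<lambda>t. poly q (f t))" for q
    using f by (intro continuous_intros)
  have "(\<lambda>n. poly_op (p n) (fun_calc f A)) \<longlonglongrightarrow> fun_calc (\<lambda>t. g (f t)) A"
  proof (rule tendstoI)
    fix e :: real
    assume "0 < e"
    then have "0 < e / 2"
      by simp
    show "\<forall>\<^sub>F n in sequentially. dist (poly_op (p n) (fun_calc f A)) (fun_calc (\<lambda>t. g (f t)) A) < e"
      using uniform_limitD [OF p \<open>0 < e / 2\<close>]
    proof eventually_elim
      case (elim n)
      have "norm (fun_calc (\<lambda>t. poly (p n) (f t) - g (f t)) A) \<le> e / 2"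
        using elim le \<open>0 < e\<close>
        by (intro norm_fun_calc_le [OF A] continuous_intros pf gf)
          (auto simp: dist_real_def intro: less_imp_le)
      then show ?case
        using \<open>0 < e\<close>
        by (simp add: fun_calc_diff [OF A pf gf] fun_calc_poly_compose [OF A f] dist_norm)
    qed
  qed
  then show ?thesis
    using fun_calc_tendsto [OF fun_calc_between [OF A f le] g p] LIMSEQ_unique by blast
qed

lemma tendsto_poly_op: "(B \<longlongrightarrow> A) F \<Longrightarrow> ((\<lambda>i. poly_op q (B i)) \<longlongrightarrow> poly_op q A) F"
  by (induction q) (auto simp: poly_op_pCons
      intro!: tendsto_intros bounded_bilinear.tendsto [OF bounded_bilinear_blinfun_compose])

text \<open>One polynomial within e/3 of f on [a,b] serves all operators of the order interval
  simultaneously, and polynomials are norm continuous.\<close>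

lemma tendsto_fun_calc:
  assumes B: "(B \<longlongrightarrow> A) F" "\<forall>\<^sub>F i in F. B i \<in> ops_between a b"
    and A: "A \<in> ops_between a b" and f: "continuous_on {a..b} f"
  shows "((\<lambda>i. fun_calc f (B i)) \<longlongrightarrow> fun_calc f A) F"
proof (rule tendstoI)
  fix e :: real
  assume "0 < e"
  then have "0 < e / 3"
    by simp
  then obtain q where q: "\<And>t. t \<in> {a..b} \<Longrightarrow> \<bar>poly q t - f t\<bar> < e / 3"
    using ex_poly_approx [OF f] by metis
  have near: "dist (poly_op q C) (fun_calc f C) \<le> e / 3" if C: "C \<in> ops_between a b" for C
  proof -
    have "norm (fun_calc (\<lambda>t. poly q t - f t) C) \<le> e / 3"
      using \<open>0 < e\<close> q by (intro norm_fun_calc_le [OF C] continuous_intros f) (auto intro: less_imp_le)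
    then show ?thesis
      by (simp add: fun_calc_diff [OF C _ f] continuous_intros fun_calc_poly [OF C] dist_norm)
  qed
  have "\<forall>\<^sub>F i in F. dist (poly_op q (B i)) (poly_op q A) < e / 3"
    using tendstoD [OF tendsto_poly_op [OF B(1)] \<open>0 < e / 3\<close>] .
  then show "\<forall>\<^sub>F i in F. dist (fun_calc f (B i)) (fun_calc f A) < e"
    using B(2)
  proof eventually_elim
    case (elim i)
    have "dist (fun_calc f (B i)) (fun_calc f A)
        \<le> dist (poly_op q (B i)) (fun_calc f (B i)) + dist (poly_op q (B i)) (fun_calc f A)"
      by (rule dist_triangle3)
    also have "dist (poly_op q (B i)) (fun_calc f A)
        \<le> dist (poly_op q (B i)) (poly_op q A) + dist (poly_op q A) (fun_calc f A)"
      by (rule dist_triangle)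
    finally show ?case
      using near [OF elim(2)] near [OF A] elim(1) by linarith
  qed
qed

subsection \<open>Powers of positive operators\<close>

lemma continuous_on_powr_interval:
  fixes r :: real
  assumes "0 < a \<or> 0 \<le> a \<and> 0 < r"
  shows "continuous_on {a..b} (\<lambda>t. t powr r)"
  by (rule continuous_on_powr') (use assms in \<open>auto intro: continuous_intros\<close>)

lemma opowr_pos:
  assumes "A \<in> pos_ops" "0 < r"
  shows "A opowr r \<in> pos_ops"
proof -
  have "A opowr r \<in> ops_between 0 (norm A powr r)"
    unfolding op_powr_def using assms
    by (intro fun_calc_between [OF pos_ops_between continuous_on_powr_interval])
      (auto intro: powr_mono2)
  then show ?thesis
    by (rule ops_between_pos) simp
qed

lemma opowr_opowr_inverse:
  assumes "A \<in> pos_ops" "0 < r" "r * s = 1"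
  shows "(A opowr r) opowr s = A"
proof -
  have "0 < s"
    using assms(2,3) by (metis zero_less_mult_pos zero_less_one)
  have A: "A \<in> ops_between 0 (norm A)"
    using assms(1) by (rule pos_ops_between)
  have "(A opowr r) opowr s = fun_calc (\<lambda>t. (t powr r) powr s) A"
    unfolding op_powr_def using \<open>0 < r\<close> \<open>0 < s\<close>
    by (intro fun_calc_compose [OF A, where c = 0 and d = "norm A powr r"] continuous_on_powr_interval)
      (auto intro: powr_mono2)
  also have "\<dots> = fun_calc (\<lambda>t. t) A"
    by (rule fun_calc_cong [OF A, symmetric]) (auto simp: powr_powr assms(3))
  finally show ?thesis
    by (simp add: fun_calc_id [OF A])
qed

subsection \<open>Kubo--Ando power means\<close>

text \<open>
  The case distinction gives the representing function its limit at \<open>0\<close>, since \<open>0 powr p = 0\<close>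
  also for negative \<open>p\<close>.
\<close>

definition power_mean_fun :: "real \<Rightarrow> real \<Rightarrow> real" where
  "power_mean_fun p t = (if t = 0 \<and> p < 0 then 0 else ((1 + t powr p) / 2) powr (1 / p))"

lemma power_mean_fun_pos: "0 \<le> t \<Longrightarrow> 0 < p \<Longrightarrow> 0 < power_mean_fun p t"
  using add_pos_nonneg [OF zero_less_one powr_ge_zero, of t p] by (simp add: power_mean_fun_def)

lemma power_mean_fun_one [simp]: "power_mean_fun p 1 = 1"
  by (simp add: power_mean_fun_def)

lemma power_mean_fun_minus:
  assumes "0 < p" "0 < t"
  shows "power_mean_fun (- p) t = 1 / power_mean_fun p (1 / t)"
  using assms by (simp add: power_mean_fun_def powr_minus_divide powr_divide)

text \<open>This is symmetry of the mean in its two arguments, read off the representing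
  function.\<close>

lemma power_mean_fun_transpose:
  assumes "0 < p" "0 < t"
  shows "power_mean_fun p t = t * power_mean_fun p (1 / t)"
proof -
  have "(1 + t powr p) / 2 = t powr p * ((1 + (1 / t) powr p) / 2)"
    using assms by (simp add: powr_divide field_simps)
  then have "((1 + t powr p) / 2) powr (1 / p)
      = (t powr p) powr (1 / p) * ((1 + (1 / t) powr p) / 2) powr (1 / p)"
    by (simp only: powr_mult)
  then show ?thesis
    using assms by (simp add: power_mean_fun_def powr_powr)
qed

text \<open>Duality between p and -p combined with symmetry. In this form it also covers t = 0, and
  it reduces negative exponents to positive ones.\<close>

lemma power_mean_fun_minus':
  assumes "0 < p" "0 \<le> t"
  shows "power_mean_fun (- p) t = t / power_mean_fun p t"
proof (cases "t = 0")
  case True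
  then show ?thesis
    using assms by (simp add: power_mean_fun_def)
next
  case False
  then show ?thesis
    using assms power_mean_fun_minus [of p t] power_mean_fun_transpose [of p t] by simp
qed

lemma continuous_on_power_mean_fun:
  assumes "p \<noteq> 0"
  shows "continuous_on {0..} (power_mean_fun p)"
proof -
  have pos: "continuous_on {0..} (power_mean_fun q)" if "0 < q" for q
  proof -
    have "continuous_on {0..} (\<lambda>t :: real. ((1 + t powr q) / 2) powr (1 / q))"
      using that by (intro continuous_intros continuous_on_powr') (auto simp: add_nonneg_eq_0_iff)
    then show ?thesis
      using that by (simp add: power_mean_fun_def [abs_def])
  qed
  show ?thesis
  proof (cases "0 < p")
    case False
    then have "0 < - p"
      using assms by simp
    have "continuous_on {0..} (\<lambda>t. t / power_mean_fun (- p) t)"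
      using power_mean_fun_pos [OF _ \<open>0 < - p\<close>]
      by (intro continuous_intros pos [OF \<open>0 < - p\<close>]) (force simp: less_imp_neq)
    then show ?thesis
      using power_mean_fun_minus' [OF \<open>0 < - p\<close>] by (simp cong: continuous_on_cong_simp)
  qed (rule pos)
qed

lemma power_mean_fun_strict_mono:
  assumes "0 < p" "0 \<le> s" "s < t"
  shows "power_mean_fun p s < power_mean_fun p t"
proof -
  have "s powr p < t powr p"
    using assms by (intro powr_less_mono2)
  then show ?thesis
    using assms by (auto simp: power_mean_fun_def intro!: powr_less_mono2 divide_right_mono add_nonneg_nonneg)
qed

lemma power_mean_fun_strict_concave:
  assumes p: "0 < p" "p < 1" and "0 \<le> a" "a < x" "x < b"
  shows "(b - x) * power_mean_fun p a + (x - a) * power_mean_fun p b < (b - a) * power_mean_fun p x"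
proof -
  let ?f = "power_mean_fun p"
  \<comment> \<open>The derivative with its two powers merged: z powr (p - 1) is absorbed by the
    bracket as (z powr (- p)) powr (1/p - 1). For 0 < p < 1 this form is visibly strictly
    decreasing.\<close>
  define D where "D z = (1 / 2) * ((1 + z powr (- p)) / 2) powr (1 / p - 1)" for z :: real
  have "p \<noteq> 0"
    using p by simp
  have deriv: "(?f has_real_derivative D z) (at z)" if "0 < z" for z
  proof -
    have pos: "0 < (1 + z powr p) / 2"
      by (simp add: add_pos_nonneg)
    have "((\<lambda>t. ((1 + t powr p) / 2) powr (1 / p)) has_real_derivative
        (1 / p) * ((1 + z powr p) / 2) powr (1 / p - 1) * (p * z powr (p - 1) / 2)) (at z)"
      using that pos \<open>p \<noteq> 0\<close> by (auto intro!: derivative_eq_intros)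
    moreover have "(1 / p) * ((1 + z powr p) / 2) powr (1 / p - 1) * (p * z powr (p - 1) / 2) = D z"
    proof -
      have "z powr (p - 1) = (z powr (- p)) powr (1 / p - 1)"
        using that p by (simp add: powr_powr right_diff_distrib)
      moreover have "((1 + z powr p) / 2) * z powr (- p) = (1 + z powr (- p)) / 2"
        using that by (simp add: distrib_right powr_add [symmetric])
      then have "((1 + z powr p) / 2) powr (1 / p - 1) * (z powr (- p)) powr (1 / p - 1)
          = ((1 + z powr (- p)) / 2) powr (1 / p - 1)"
        by (simp only: powr_mult [symmetric])
      ultimately show ?thesis
        using p by (simp add: D_def)
    qed
    ultimately show ?thesis
      using p by (simp add: power_mean_fun_def [abs_def])
  qed
  have cont: "continuous_on {u..v} ?f" if "0 \<le> u" for u v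
    using continuous_on_power_mean_fun [of p] p that by (auto elim: continuous_on_subset)
  have mvt: "\<exists>z. u < z \<and> z < v \<and> ?f v - ?f u = (v - u) * D z" if "0 \<le> u" "u < v" for u v
  proof -
    have "\<exists>l z. u < z \<and> z < v \<and> DERIV ?f z :> l \<and> ?f v - ?f u = (v - u) * l"
    proof (rule MVT [OF that(2) cont [OF that(1)]])
      fix z
      assume "u < z"
      then have "0 < z"
        using that(1) by simp
      then show "?f differentiable (at z)"
        using deriv real_differentiable_def by blast
    qed
    then obtain l z where z: "u < z" "z < v" "DERIV ?f z :> l" "?f v - ?f u = (v - u) * l"
      by blast
    then have "l = D z"
      using DERIV_unique [OF z(3) deriv] that(1) by simp
    then show ?thesis
      using z by blast
  qed
  obtain z where z: "a < z" "z < x" "?f x - ?f a = (x - a) * D z"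
    using mvt [of a x] assms by auto
  obtain w where w: "x < w" "w < b" "?f b - ?f x = (b - x) * D w"
    using mvt [of x b] assms by auto
  have "w powr (- p) < z powr (- p)"
    using z w assms by (intro powr_less_mono2_neg) auto
  then have "D w < D z"
    using p by (auto simp: D_def intro!: powr_less_mono2 add_nonneg_nonneg)
  then have "(x - a) * (b - x) * D w < (x - a) * (b - x) * D z"
    using assms by simp
  moreover have "(x - a) * (b - x) * D w = (x - a) * (?f b - ?f x)"
    by (simp add: w(3))
  moreover have "(x - a) * (b - x) * D z = (b - x) * (?f x - ?f a)"
    by (simp add: z(3))
  ultimately show ?thesis
    by (simp add: algebra_simps)
qed

text \<open>A single functional calculus with the continuously extended representing function
  replaces the nested powers of \<open>kubo_ando_mean_inv\<close>. It therefore stays meaningful for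
  noninvertible B when r < 0.\<close>

definition kubo_ando_core ::
    "real \<Rightarrow> ('a::complex_hilbert_space \<Rightarrow>\<^sub>L 'a) \<Rightarrow> ('a \<Rightarrow>\<^sub>L 'a) \<Rightarrow> ('a \<Rightarrow>\<^sub>L 'a)" where
  "kubo_ando_core r A B = A opowr (1/2) o\<^sub>L
     fun_calc (power_mean_fun r) (A opowr (-1/2) o\<^sub>L B o\<^sub>L A opowr (-1/2)) o\<^sub>L A opowr (1/2)"

lemma opowr_sa:
  assumes "A \<in> ops_between c M" "0 < c"
  shows "A opowr r \<in> sa_ops"
  unfolding op_powr_def using assms by (intro fun_calc_sa continuous_on_powr_interval) auto

lemma opowr_add:
  assumes "A \<in> ops_between c M" "0 < c"
  shows "A opowr r o\<^sub>L A opowr s = fun_calc (\<lambda>t. t powr (r + s)) A"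
  using assms(2) fun_calc_mult [OF assms(1) continuous_on_powr_interval continuous_on_powr_interval]
  by (simp add: op_powr_def powr_add)

lemma opowr_half_cancel:
  assumes A: "A \<in> ops_between c M" "0 < c"
  shows "(A opowr (1/2)) ((A opowr (-1/2)) x) = x" "(A opowr (-1/2)) ((A opowr (1/2)) x) = x"
    and "(A opowr (1/2)) ((A opowr (1/2)) x) = A x"
proof -
  have "fun_calc (\<lambda>t. 1) A = fun_calc (\<lambda>t. t powr 0) A"
    using A(2) by (intro fun_calc_cong [OF A(1)]) auto
  then have "fun_calc (\<lambda>t. t powr 0) A = id_blinfun"
    using fun_calc_const [OF A(1), of 1] by simp
  then have "A opowr (1/2) o\<^sub>L A opowr (-1/2) = id_blinfun" "A opowr (-1/2) o\<^sub>L A opowr (1/2) = id_blinfun"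
    by (simp_all add: opowr_add [OF A])
  then show "(A opowr (1/2)) ((A opowr (-1/2)) x) = x" "(A opowr (-1/2)) ((A opowr (1/2)) x) = x"
    by (metis blinfun_apply_blinfun_compose blinfun_apply_id_blinfun)+
  have "fun_calc (\<lambda>t. t) A = fun_calc (\<lambda>t. t powr 1) A"
    using A(2) by (intro fun_calc_cong [OF A(1)]) auto
  then have "A opowr (1/2) o\<^sub>L A opowr (1/2) = A"
    by (simp add: opowr_add [OF A] fun_calc_id [OF A(1)])
  then show "(A opowr (1/2)) ((A opowr (1/2)) x) = A x"
    by (metis blinfun_apply_blinfun_compose)
qed

text \<open>From x = A^(1/2) A^(-1/2) x follows a lower bound for the norm of A^(-1/2) x, and B >=
  dI carries it to the form. The summand 1 in \<open>l\<close> keeps the denominator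
  positive.\<close>

lemma conjugate_coercive:
  assumes A: "A \<in> ops_between c M" "0 < c" and B: "B \<in> ops_between d D" "0 < d"
  obtains l u where "0 < l" "A opowr (-1/2) o\<^sub>L B o\<^sub>L A opowr (-1/2) \<in> ops_between l u"
proof -
  define R where "R = A opowr (1/2)"
  define N where "N = A opowr (-1/2)"
  let ?X = "N o\<^sub>L B o\<^sub>L N"
  define l where "l = d / (norm R + 1)\<^sup>2"
  have N: "N \<in> sa_ops"
    unfolding N_def using A by (rule opowr_sa)
  have "l * (norm x)\<^sup>2 \<le> inner (?X x) x" for x
  proof -
    have "norm x = norm (R (N x))"
      unfolding R_def N_def opowr_half_cancel(1) [OF A] ..
    also have "\<dots> \<le> norm R * norm (N x)"
      by (rule norm_blinfun)
    also have "\<dots> \<le> (norm R + 1) * norm (N x)"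
      by (simp add: mult_right_mono)
    finally have "(norm x)\<^sup>2 \<le> ((norm R + 1) * norm (N x))\<^sup>2"
      by (simp add: power_mono)
    moreover have "norm R + 1 \<noteq> 0"
      using norm_ge_zero [of R] by linarith
    then have "0 < (norm R + 1)\<^sup>2"
      by simp
    ultimately have "(norm x)\<^sup>2 / (norm R + 1)\<^sup>2 \<le> (norm (N x))\<^sup>2"
      by (simp add: pos_divide_le_eq power_mult_distrib mult.commute)
    then have "d * ((norm x)\<^sup>2 / (norm R + 1)\<^sup>2) \<le> d * (norm (N x))\<^sup>2"
      using B(2) by (intro mult_left_mono) auto
    also have "\<dots> \<le> inner (B (N x)) (N x)"
      by (rule ops_betweenD(1) [OF B(1)])
    finally show ?thesis
      by (simp add: l_def sa_opsD [OF N])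
  qed
  moreover have X: "?X \<in> sa_ops"
    by (rule sa_ops_conjugate [OF N ops_between_sa [OF B(1)]])
  ultimately have "?X \<in> ops_between l (norm ?X)"
    using ops_betweenD(2) [OF sa_ops_between [OF X]] by (simp add: ops_between_def)
  moreover have "norm R + 1 \<noteq> 0"
    using norm_ge_zero [of R] by linarith
  then have "0 < l"
    using B(2) by (simp add: l_def)
  ultimately show ?thesis
    using that unfolding N_def by blast
qed

lemma kubo_ando_mean_inv_eq:
  assumes A: "A \<in> ops_between c M" "0 < c" and B: "B \<in> ops_between d D" "0 < d" and "r \<noteq> 0"
  shows "kubo_ando_mean_inv r A B = kubo_ando_core r A B"
proof -
  define X where "X = A opowr (-1/2) o\<^sub>L B o\<^sub>L A opowr (-1/2)"
  then have core: "kubo_ando_core r A B = A opowr (1/2) o\<^sub>L fun_calc (power_mean_fun r) X o\<^sub>L A opowr (1/2)"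
    and inv: "kubo_ando_mean_inv r A B
      = A opowr (1/2) o\<^sub>L ((1/2) *\<^sub>R (id_blinfun + X opowr r)) opowr (1/r) o\<^sub>L A opowr (1/2)"
    by (simp_all only: kubo_ando_core_def kubo_ando_mean_inv_def)
  obtain l u where "0 < l" and X: "X \<in> ops_between l u"
    using conjugate_coercive [OF A B] unfolding X_def by blast
  have f: "continuous_on {l..u} (\<lambda>t. t powr r)"
    using \<open>0 < l\<close> by (intro continuous_on_powr_interval) simp
  then have f': "continuous_on {l..u} (\<lambda>t. 1 + t powr r)"
    by (rule continuous_on_add [OF continuous_on_const])
  have "compact ((\<lambda>t. t powr r) ` {l..u})"
    using f by (intro compact_continuous_image) auto
  then have "bdd_above ((\<lambda>t. t powr r) ` {l..u})"
    by (intro bounded_imp_bdd_above compact_imp_bounded)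
  then obtain U where U: "\<forall>t\<in>{l..u}. t powr r \<le> U"
    by (auto simp: bdd_above_def)
  have "fun_calc (\<lambda>t. 1/2 * (1 + t powr r)) X = (1/2) *\<^sub>R (1 *\<^sub>R id_blinfun + X opowr r)"
    unfolding fun_calc_scaleR [OF X f'] fun_calc_add [OF X continuous_on_const f]
      fun_calc_const [OF X] op_powr_def ..
  then have "(1/2) *\<^sub>R (id_blinfun + X opowr r) = fun_calc (\<lambda>t. 1/2 * (1 + t powr r)) X"
    by (simp only: scaleR_one)
  then have "((1/2) *\<^sub>R (id_blinfun + X opowr r)) opowr (1/r)
      = fun_calc (\<lambda>t. t powr (1/r)) (fun_calc (\<lambda>t. 1/2 * (1 + t powr r)) X)"
    by (simp only: op_powr_def)
  also have "\<dots> = fun_calc (\<lambda>t. (1/2 * (1 + t powr r)) powr (1/r)) X"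
  proof (rule fun_calc_compose [OF X])
    show "continuous_on {l..u} (\<lambda>t. 1/2 * (1 + t powr r))"
      using f' by (rule continuous_on_mult_left)
    \<comment> \<open>The inner function takes values at least 1/2, so the outer power is continuous
      even when 1/r is negative.\<close>
    show "continuous_on {1/2..(1 + U) / 2} (\<lambda>t. t powr (1/r))"
      by (rule continuous_on_powr_interval) simp
    show "1/2 \<le> 1/2 * (1 + t powr r) \<and> 1/2 * (1 + t powr r) \<le> (1 + U) / 2" if "t \<in> {l..u}" for t
      using U that by (simp add: Ball_def)
  qed
  also have "\<dots> = fun_calc (power_mean_fun r) X"
  proof (rule fun_calc_cong [OF X, symmetric])
    show "continuous_on {l..u} (power_mean_fun r)"
      using continuous_on_power_mean_fun [OF \<open>r \<noteq> 0\<close>] \<open>0 < l\<close> by (auto elim: continuous_on_subset)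
  qed (use \<open>0 < l\<close> in \<open>simp add: power_mean_fun_def\<close>)
  finally show ?thesis
    by (simp only: core inv)
qed

lemma kubo_ando_power_mean_eqI:
  fixes T :: "'a::complex_hilbert_space \<Rightarrow>\<^sub>L 'a"
  assumes "\<And>x. ((\<lambda>\<epsilon>. kubo_ando_mean_inv r (A + \<epsilon> *\<^sub>R id_blinfun) (B + \<epsilon> *\<^sub>R id_blinfun) x)
      \<longlongrightarrow> T x) (at_right 0)"
  shows "kubo_ando_power_mean r A B = T"
  unfolding kubo_ando_power_mean_def
proof (rule the_equality)
  fix S
  assume "\<forall>x. ((\<lambda>\<epsilon>. kubo_ando_mean_inv r (A + \<epsilon> *\<^sub>R id_blinfun) (B + \<epsilon> *\<^sub>R id_blinfun) x)
      \<longlongrightarrow> blinfun_apply S x) (at_right 0)"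
  then have "S x = T x" for x
    using tendsto_unique [OF trivial_limit_at_right_real _ assms] by blast
  then show "S = T"
    by (rule blinfun_eqI)
qed (use assms in blast)

lemma eventually_at_right_unit: "\<forall>\<^sub>F \<epsilon> in at_right 0. 0 < \<epsilon> \<and> \<epsilon> < (1 :: real)"
  using eventually_at_right_real [of 0 "1 :: real"] by (simp add: greaterThanLessThan_def)

text \<open>As the regularized first arguments stay above cI, their powers converge in norm and the
  conjugated second arguments stay in one order interval starting at 0. Continuity of the
  representing function at 0 then gives norm convergence of the means.\<close>

lemma kubo_ando_power_mean_invertible:
  assumes A: "A \<in> ops_between c M" "0 < c" and B: "B \<in> pos_ops" and "r \<noteq> 0"
  shows "kubo_ando_power_mean r A B = kubo_ando_core r A B"
proof (rule kubo_ando_power_mean_eqI)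
  fix x
  define A' where "A' \<epsilon> = A + \<epsilon> *\<^sub>R id_blinfun" for \<epsilon>
  define B' where "B' \<epsilon> = B + \<epsilon> *\<^sub>R id_blinfun" for \<epsilon>
  \<comment> \<open>This bounds the norm of \<open>A' \<epsilon> opowr (-1/2)\<close> uniformly,
    because t powr (-1/2) is largest at the lower end c.\<close>
  define n where "n = c powr (-1/2)"
  define D where "D = norm B + 1"
  let ?X = "\<lambda>\<epsilon>. A' \<epsilon> opowr (-1/2) o\<^sub>L B' \<epsilon> o\<^sub>L A' \<epsilon> opowr (-1/2)"
  have "((\<lambda>\<epsilon>. A' \<epsilon>) \<longlongrightarrow> A + 0 *\<^sub>R id_blinfun) (at_right 0)"
      "((\<lambda>\<epsilon>. B' \<epsilon>) \<longlongrightarrow> B + 0 *\<^sub>R id_blinfun) (at_right 0)"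
    unfolding A'_def B'_def
    by (intro tendsto_add tendsto_scaleR tendsto_const tendsto_ident_at)+
  then have lim: "(A' \<longlongrightarrow> A' 0) (at_right 0)" "(B' \<longlongrightarrow> B' 0) (at_right 0)"
    unfolding A'_def B'_def .
  have A': "A' \<epsilon> \<in> ops_between c (M + 1)" if "0 \<le> \<epsilon>" "\<epsilon> < 1" for \<epsilon>
    unfolding A'_def by (rule ops_between_mono [OF ops_between_add_id [OF A(1)]]) (use that in auto)
  have B': "B' \<epsilon> \<in> ops_between \<epsilon> D" if "0 \<le> \<epsilon>" "\<epsilon> < 1" for \<epsilon>
    unfolding B'_def D_def
    by (rule ops_between_mono [OF ops_between_add_id [OF pos_ops_between [OF B]]]) (use that in auto)
  have ev: "\<forall>\<^sub>F \<epsilon> in at_right 0. A' \<epsilon> \<in> ops_between c (M + 1)"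
    using eventually_at_right_unit by eventually_elim (use A' in auto)
  have pow: "((\<lambda>\<epsilon>. A' \<epsilon> opowr s) \<longlongrightarrow> A' 0 opowr s) (at_right 0)" for s
    unfolding op_powr_def using A(2)
    by (intro tendsto_fun_calc [OF lim(1) ev A'] continuous_on_powr_interval) auto
  note compose = bounded_bilinear.tendsto [OF bounded_bilinear_blinfun_compose]
  have X: "?X \<epsilon> \<in> ops_between 0 (D * n\<^sup>2)" if "0 \<le> \<epsilon>" "\<epsilon> < 1" for \<epsilon>
  proof -
    have "norm (A' \<epsilon> opowr (-1/2)) \<le> n"
      unfolding op_powr_def
    proof (rule norm_fun_calc_le [OF A' [OF that]])
      show "continuous_on {c..M + 1} (\<lambda>t. t powr (-1/2))"
        using A(2) by (intro continuous_on_powr_interval) simp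
      show "\<bar>t powr (-1/2)\<bar> \<le> n" if "t \<in> {c..M + 1}" for t
        using powr_mono2' [of "-1/2" c t] A(2) that by (simp add: n_def)
    qed (simp add: n_def)
    then have "D * (norm (A' \<epsilon> opowr (-1/2)))\<^sup>2 \<le> D * n\<^sup>2"
      by (intro mult_left_mono power_mono) (auto simp: D_def)
    moreover have "?X \<epsilon> \<in> ops_between 0 (D * (norm (A' \<epsilon> opowr (-1/2)))\<^sup>2)"
    proof (rule ops_between_conjugate)
      show "A' \<epsilon> opowr (-1/2) \<in> sa_ops"
        using A' [OF that] A(2) by (rule opowr_sa)
      show "B' \<epsilon> \<in> ops_between 0 D"
        using B' [OF that] by (rule ops_between_mono) (use that in auto)
    qed (simp add: D_def)
    ultimately show ?thesis
      using ops_between_mono by blast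
  qed
  have "((\<lambda>\<epsilon>. kubo_ando_core r (A' \<epsilon>) (B' \<epsilon>)) \<longlongrightarrow> kubo_ando_core r (A' 0) (B' 0)) (at_right 0)"
    unfolding kubo_ando_core_def
  proof (intro compose pow)
    show "((\<lambda>\<epsilon>. fun_calc (power_mean_fun r) (?X \<epsilon>)) \<longlongrightarrow> fun_calc (power_mean_fun r) (?X 0)) (at_right 0)"
    proof (rule tendsto_fun_calc)
      show "(?X \<longlongrightarrow> ?X 0) (at_right 0)"
        by (intro compose pow lim(2))
      show "\<forall>\<^sub>F \<epsilon> in at_right 0. ?X \<epsilon> \<in> ops_between 0 (D * n\<^sup>2)"
        using eventually_at_right_unit by eventually_elim (use X in auto)
      show "continuous_on {0..D * n\<^sup>2} (power_mean_fun r)"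
        using continuous_on_power_mean_fun [OF \<open>r \<noteq> 0\<close>]
        by (rule continuous_on_subset) simp
    qed (rule X, simp_all)
  qed
  then have "((\<lambda>\<epsilon>. kubo_ando_core r (A' \<epsilon>) (B' \<epsilon>) x) \<longlongrightarrow> kubo_ando_core r (A' 0) (B' 0) x) (at_right 0)"
    by (rule blinfun.tendsto [OF _ tendsto_const])
  moreover have "\<forall>\<^sub>F \<epsilon> in at_right 0. kubo_ando_core r (A' \<epsilon>) (B' \<epsilon>) x = kubo_ando_mean_inv r (A' \<epsilon>) (B' \<epsilon>) x"
    using eventually_at_right_unit
  proof eventually_elim
    case (elim \<epsilon>)
    then show ?case
      using kubo_ando_mean_inv_eq [OF A' A(2) B' _ \<open>r \<noteq> 0\<close>, of \<epsilon> \<epsilon>] by simp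
  qed
  ultimately have "((\<lambda>\<epsilon>. kubo_ando_mean_inv r (A' \<epsilon>) (B' \<epsilon>) x) \<longlongrightarrow> kubo_ando_core r (A' 0) (B' 0) x) (at_right 0)"
    by (rule Lim_transform_eventually)
  then show "((\<lambda>\<epsilon>. kubo_ando_mean_inv r (A + \<epsilon> *\<^sub>R id_blinfun) (B + \<epsilon> *\<^sub>R id_blinfun) x)
      \<longlongrightarrow> kubo_ando_core r A B x) (at_right 0)"
    by (simp add: A'_def B'_def)
qed

subsection \<open>Means with projections and rank-one operators\<close>

lemma sa_projection_norm:
  assumes "P \<in> sa_ops" "P o\<^sub>L P = P"
  shows "inner (P x) x = (norm (P x))\<^sup>2"
proof -
  have "P (P x) = P x"
    by (metis assms(2) blinfun_apply_blinfun_compose)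
  then show ?thesis
    using sa_opsD [OF assms(1), of "P x" x] by (simp add: power2_norm_eq_inner)
qed

lemma projection_combination_between:
  assumes P: "P \<in> sa_ops" "P o\<^sub>L P = P"
    and "lo \<le> a" "lo \<le> b" "a \<le> hi" "b \<le> hi"
  shows "a *\<^sub>R P + b *\<^sub>R (id_blinfun - P) \<in> ops_between lo hi"
proof -
  let ?T = "a *\<^sub>R P + b *\<^sub>R (id_blinfun - P)"
  have "lo * (norm x)\<^sup>2 \<le> inner (?T x) x \<and> inner (?T x) x \<le> hi * (norm x)\<^sup>2" for x
  proof -
    have "P (P x) = P x"
      by (metis assms(2) blinfun_apply_blinfun_compose)
    then have "(norm (x - P x))\<^sup>2 = inner x x - inner (P x) x"
      using sa_opsD [OF P(1), of "P x" x]
      by (simp add: power2_norm_eq_inner inner_diff inner_commute)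
    moreover have "inner (?T x) x = a * inner (P x) x + b * (inner x x - inner (P x) x)"
      by (simp add: blinfun.add_left blinfun.scaleR_left blinfun.diff_left inner_add_left inner_diff_left)
    ultimately have eq: "inner (?T x) x = a * (norm (P x))\<^sup>2 + b * (norm (x - P x))\<^sup>2"
      and x: "(norm x)\<^sup>2 = (norm (P x))\<^sup>2 + (norm (x - P x))\<^sup>2"
      by (simp_all add: sa_projection_norm [OF P] power2_norm_eq_inner)
    show ?thesis
      unfolding eq x distrib_left using assms(3-)
      by (intro conjI add_mono mult_right_mono) auto
  qed
  then show ?thesis
    using P(1) by (simp add: ops_between_def sa_ops_add sa_ops_scaleR sa_ops_diff sa_ops_id)
qed

section \<open>Calculus in the span of a projection and its complement\<close>

lemma poly_op_projection_combination:
  assumes "P o\<^sub>L P = P"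
  shows "poly_op q (a *\<^sub>R P + b *\<^sub>R (id_blinfun - P)) = poly q a *\<^sub>R P + poly q b *\<^sub>R (id_blinfun - P)"
proof (induction q)
  case 0
  then show ?case
    by simp
next
  case (pCons c q)
  have PP: "P (P x) = P x" for x
    by (metis assms blinfun_apply_blinfun_compose)
  show ?case
    unfolding poly_op_pCons pCons.IH
    by (rule blinfun_eqI)
      (simp add: PP blinfun.add_left blinfun.diff_left blinfun.scaleR_left
        blinfun.add_right blinfun.diff_right blinfun.scaleR_right algebra_simps)
qed

lemma fun_calc_projection_combination:
  assumes P: "P \<in> sa_ops" "P o\<^sub>L P = P"
    and f: "continuous_on {lo..hi} f" and ab: "a \<in> {lo..hi}" "b \<in> {lo..hi}"
  shows "fun_calc f (a *\<^sub>R P + b *\<^sub>R (id_blinfun - P)) = f a *\<^sub>R P + f b *\<^sub>R (id_blinfun - P)"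
proof -
  let ?T = "a *\<^sub>R P + b *\<^sub>R (id_blinfun - P)"
  obtain p where p: "uniform_limit {lo..hi} (\<lambda>n. poly (p n)) f sequentially"
    using ex_poly_uniform_limit [OF f] .
  have "?T \<in> ops_between lo hi"
    using ab by (intro projection_combination_between [OF P]) auto
  then have "(\<lambda>n. poly_op (p n) ?T) \<longlonglongrightarrow> fun_calc f ?T"
    using f p by (rule fun_calc_tendsto)
  moreover have "(\<lambda>n. poly_op (p n) ?T) \<longlonglongrightarrow> f a *\<^sub>R P + f b *\<^sub>R (id_blinfun - P)"
    unfolding poly_op_projection_combination [OF P(2)]
    by (intro tendsto_add tendsto_scaleR tendsto_const tendsto_uniform_limitI [OF p] ab)
  ultimately show ?thesis
    by (rule LIMSEQ_unique)
qed

lemma kubo_ando_core_projection_combination: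
  assumes P: "P \<in> sa_ops" "P o\<^sub>L P = P"
    and pos: "0 < a" "0 < b" "0 \<le> c" "0 \<le> d" and "r \<noteq> 0"
  shows "kubo_ando_core r (a *\<^sub>R P + b *\<^sub>R (id_blinfun - P)) (c *\<^sub>R P + d *\<^sub>R (id_blinfun - P))
    = (a * power_mean_fun r (c / a)) *\<^sub>R P + (b * power_mean_fun r (d / b)) *\<^sub>R (id_blinfun - P)"
proof -
  have PP: "P (P x) = P x" for x
    by (metis P(2) blinfun_apply_blinfun_compose)
  have comp: "(s *\<^sub>R P + t *\<^sub>R (id_blinfun - P)) o\<^sub>L (u *\<^sub>R P + v *\<^sub>R (id_blinfun - P))
      = (s * u) *\<^sub>R P + (t * v) *\<^sub>R (id_blinfun - P)" for s t u v
    by (rule blinfun_eqI)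
      (simp add: PP blinfun.add_left blinfun.diff_left blinfun.scaleR_left
        blinfun.add_right blinfun.diff_right blinfun.scaleR_right algebra_simps)
  have pow: "(a *\<^sub>R P + b *\<^sub>R (id_blinfun - P)) opowr s = (a powr s) *\<^sub>R P + (b powr s) *\<^sub>R (id_blinfun - P)" for s
    unfolding op_powr_def
  proof (rule fun_calc_projection_combination [OF P])
    show "continuous_on {min a b..max a b} (\<lambda>t. t powr s)"
      using pos by (intro continuous_on_powr_interval) simp
  qed auto
  have neg: "x powr (-1/2) * y * x powr (-1/2) = y / x" if "0 < x" for x y :: real
  proof -
    have "x powr (-1/2) * x powr (-1/2) = 1 / x"
      using that by (simp add: powr_add [symmetric] powr_minus_divide)
    then have "x powr (-1/2) * x powr (-1/2) * y = 1 / x * y"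
      by simp
    then show ?thesis
      by (simp add: mult_ac)
  qed
  have half: "x powr (1/2) * y * x powr (1/2) = x * y" if "0 < x" for x y :: real
  proof -
    have "x powr (1/2) * x powr (1/2) * y = x * y"
      using that by (simp add: powr_add [symmetric])
    then show ?thesis
      by (simp add: mult_ac)
  qed
  have "fun_calc (power_mean_fun r) ((c / a) *\<^sub>R P + (d / b) *\<^sub>R (id_blinfun - P))
      = power_mean_fun r (c / a) *\<^sub>R P + power_mean_fun r (d / b) *\<^sub>R (id_blinfun - P)"
  proof (rule fun_calc_projection_combination [OF P])
    show "continuous_on {0..max (c / a) (d / b)} (power_mean_fun r)"
      using continuous_on_power_mean_fun [OF \<open>r \<noteq> 0\<close>] by (rule continuous_on_subset) simp
  qed (use pos in auto)
  then show ?thesis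
    unfolding kubo_ando_core_def pow comp neg [OF pos(1)] neg [OF pos(2)]
    by (simp only: comp half [OF pos(1)] half [OF pos(2)])
qed

text \<open>Neither argument need be invertible, so the defining limit is evaluated directly. On the
  range of P the regularized mean has the factor (1 + \<epsilon>) f((b + \<epsilon>)/(1 +
  \<epsilon>)), where f is the representing function; on the complement it is \<epsilon> f(1) =
  \<epsilon>, which vanishes.\<close>

lemma kubo_ando_power_mean_projection:
  assumes P: "P \<in> sa_ops" "P o\<^sub>L P = P" and "0 \<le> b" "r \<noteq> 0"
  shows "kubo_ando_power_mean r P (b *\<^sub>R P) = power_mean_fun r b *\<^sub>R P"
proof (rule kubo_ando_power_mean_eqI)
  fix x
  let ?E = "\<lambda>\<epsilon>. ((1 + \<epsilon>) * power_mean_fun r ((b + \<epsilon>) / (1 + \<epsilon>))) *\<^sub>R P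
      + (\<epsilon> * power_mean_fun r (\<epsilon> / \<epsilon>)) *\<^sub>R (id_blinfun - P)"
  have arg: "((\<lambda>\<epsilon>. (b + \<epsilon>) / (1 + \<epsilon>)) \<longlongrightarrow> (b + 0) / (1 + 0)) (at_right 0)"
    by (intro tendsto_intros) auto
  have "((\<lambda>\<epsilon>. power_mean_fun r ((b + \<epsilon>) / (1 + \<epsilon>))) \<longlongrightarrow> power_mean_fun r b) (at_right 0)"
  proof (rule continuous_on_tendsto_compose [OF continuous_on_power_mean_fun [OF \<open>r \<noteq> 0\<close>]])
    show "((\<lambda>\<epsilon>. (b + \<epsilon>) / (1 + \<epsilon>)) \<longlongrightarrow> b) (at_right 0)"
      using arg by simp
    show "\<forall>\<^sub>F \<epsilon> in at_right 0. (b + \<epsilon>) / (1 + \<epsilon>) \<in> {0..}"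
      using eventually_at_right_unit by eventually_elim (use \<open>0 \<le> b\<close> in auto)
  qed (use \<open>0 \<le> b\<close> in simp)
  moreover have "\<forall>\<^sub>F \<epsilon> in at_right 0. \<epsilon> = \<epsilon> * power_mean_fun r (\<epsilon> / \<epsilon>)"
    using eventually_at_right_unit by eventually_elim simp
  then have "((\<lambda>\<epsilon>. \<epsilon> * power_mean_fun r (\<epsilon> / \<epsilon>)) \<longlongrightarrow> 0) (at_right 0)"
    by (rule Lim_transform_eventually [OF tendsto_ident_at])
  ultimately have "(?E \<longlongrightarrow> ((1 + 0) * power_mean_fun r b) *\<^sub>R P + 0 *\<^sub>R (id_blinfun - P)) (at_right 0)"
    by (intro tendsto_add tendsto_scaleR tendsto_mult tendsto_const tendsto_ident_at)
  then have "((\<lambda>\<epsilon>. ?E \<epsilon> x) \<longlongrightarrow> (power_mean_fun r b *\<^sub>R P) x) (at_right 0)"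
    using blinfun.tendsto [OF _ tendsto_const] by fastforce
  moreover have "\<forall>\<^sub>F \<epsilon> in at_right 0.
      ?E \<epsilon> x = kubo_ando_mean_inv r (P + \<epsilon> *\<^sub>R id_blinfun) (b *\<^sub>R P + \<epsilon> *\<^sub>R id_blinfun) x"
    using eventually_at_right_unit
  proof eventually_elim
    case (elim \<epsilon>)
    then have pos: "0 < 1 + \<epsilon>" "0 < \<epsilon>" "0 \<le> b + \<epsilon>" "0 \<le> \<epsilon>"
      using \<open>0 \<le> b\<close> by auto
    have split: "u *\<^sub>R P + \<epsilon> *\<^sub>R id_blinfun = (u + \<epsilon>) *\<^sub>R P + \<epsilon> *\<^sub>R (id_blinfun - P)" for u
      by (simp add: algebra_simps)
    have "u *\<^sub>R P + \<epsilon> *\<^sub>R id_blinfun \<in> ops_between \<epsilon> (u + \<epsilon>)" if "0 \<le> u" for u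
      unfolding split using that elim by (intro projection_combination_between [OF P]) auto
    then have "kubo_ando_mean_inv r (1 *\<^sub>R P + \<epsilon> *\<^sub>R id_blinfun) (b *\<^sub>R P + \<epsilon> *\<^sub>R id_blinfun)
        = kubo_ando_core r (1 *\<^sub>R P + \<epsilon> *\<^sub>R id_blinfun) (b *\<^sub>R P + \<epsilon> *\<^sub>R id_blinfun)"
      using kubo_ando_mean_inv_eq [of _ \<epsilon> _ _ \<epsilon>] elim assms(3,4) by (metis zero_le_one)
    also have "\<dots> = ?E \<epsilon>"
      unfolding split by (rule kubo_ando_core_projection_combination [OF P pos \<open>r \<noteq> 0\<close>])
    finally show ?case
      by simp
  qed
  ultimately show "((\<lambda>\<epsilon>. kubo_ando_mean_inv r (P + \<epsilon> *\<^sub>R id_blinfun) (b *\<^sub>R P + \<epsilon> *\<^sub>R id_blinfun) x)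
      \<longlongrightarrow> (power_mean_fun r b *\<^sub>R P) x) (at_right 0)"
    by (rule Lim_transform_eventually)
qed

section \<open>Rank-one operators\<close>

definition rank_one :: "'a::complex_hilbert_space \<Rightarrow> 'a \<Rightarrow>\<^sub>L 'a" where
  "rank_one h = Blinfun (\<lambda>x. cinner x h *\<^sub>C h)"

lemma rank_one_apply: "rank_one h x = cinner x h *\<^sub>C h"
proof -
  have "bounded_linear (\<lambda>x. cinner x h *\<^sub>C h)"
  proof (rule bounded_linear_intro [where K = "norm h * norm h"])
    show "cinner (x + y) h *\<^sub>C h = cinner x h *\<^sub>C h + cinner y h *\<^sub>C h" for x y
      by (simp add: cinner_add_left scaleC_add_left)
    show "cinner (r *\<^sub>R x) h *\<^sub>C h = r *\<^sub>R cinner x h *\<^sub>C h" for r x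
      by (simp add: scaleR_scaleC cinner_scaleC_left scaleC_scaleC)
    show "norm (cinner x h *\<^sub>C h) \<le> norm x * (norm h * norm h)" for x
      using mult_right_mono [OF cinner_Cauchy_Schwarz [of x h] norm_ge_zero [of h]]
      by (simp add: norm_scaleC mult.assoc)
  qed
  then show ?thesis
    by (simp add: rank_one_def bounded_linear_Blinfun_apply)
qed

lemma inner_rank_one: "inner (rank_one h x) x = (cmod (cinner x h))\<^sup>2"
proof -
  have "cinner (rank_one h x) x = cinner x h * cnj (cinner x h)"
    by (simp add: rank_one_apply cinner_scaleC_left cinner_commute [of h x])
  also have "\<dots> = complex_of_real ((cmod (cinner x h))\<^sup>2)"
    by (simp only: complex_norm_square)
  finally show ?thesis
    by (simp add: inner_eq_Re_cinner)
qed

lemma rank_one_pos: "rank_one h \<in> pos_ops"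
  unfolding pos_ops_iff
proof
  have "rank_one h (c *\<^sub>C x) = c *\<^sub>C rank_one h x" for c x
    by (simp add: rank_one_apply cinner_scaleC_left scaleC_scaleC)
  moreover have "inner (rank_one h x) y = inner x (rank_one h y)" for x y
    by (simp add: rank_one_apply inner_eq_Re_cinner cinner_scaleC_left cinner_scaleC_right
        cinner_commute [of h y] mult.commute)
  ultimately show "rank_one h \<in> sa_ops"
    by (simp add: sa_ops_def bounded_ops_def)
  show "\<forall>x. 0 \<le> inner (rank_one h x) x"
    by (simp add: inner_rank_one)
qed

lemma rank_one_sa: "rank_one h \<in> sa_ops"
  using rank_one_pos [of h] by (simp add: pos_ops_iff)

lemma rank_one_compose_self: "rank_one h o\<^sub>L rank_one h = (norm h)\<^sup>2 *\<^sub>R rank_one h"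
  by (rule blinfun_eqI)
    (simp add: rank_one_apply cinner_scaleC_left cinner_self blinfun.scaleR_left scaleR_scaleC
      scaleC_scaleC mult.commute)

lemma rank_one_conjugate:
  assumes "S \<in> sa_ops"
  shows "S o\<^sub>L rank_one h o\<^sub>L S = rank_one (S h)"
  by (rule blinfun_eqI)
    (simp add: rank_one_apply bounded_opsD [OF sa_ops_bounded [OF assms]] sa_ops_cinner [OF assms])

text \<open>Here y is the inverse of A applied to h, and s is the squared norm of A^(-1/2) h.
  Conjugating b times the rank-one operator by A^(-1/2) gives (b s) P with a projection P, whose
  calculus has only the values at b s and 0; conjugating back by A^(1/2) gives the formula.\<close>

lemma kubo_ando_power_mean_rank_one:
  assumes A: "A \<in> ops_between c M" "0 < c" and y: "A y = h" and "h \<noteq> 0" and "0 \<le> b" "r \<noteq> 0"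
  defines "s \<equiv> inner y h"
  shows "kubo_ando_power_mean r A (b *\<^sub>R rank_one h) =
    power_mean_fun r 0 *\<^sub>R A + ((power_mean_fun r (b * s) - power_mean_fun r 0) / s) *\<^sub>R rank_one h"
proof -
  define R where "R = A opowr (1/2)"
  define N where "N = A opowr (-1/2)"
  define P where "P = (1 / s) *\<^sub>R rank_one (N h)"
  let ?f = "power_mean_fun r"
  have sa: "R \<in> sa_ops" "N \<in> sa_ops"
    unfolding R_def N_def by (rule opowr_sa [OF A])+
  have cancel: "R (N x) = x" "N (R x) = x" "R (R x) = A x" for x
    unfolding R_def N_def by (rule opowr_half_cancel [OF A])+
  have "y \<noteq> 0"
    using y \<open>h \<noteq> 0\<close> by auto
  then have "0 < c * (norm y)\<^sup>2"
    using A(2) by simp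
  also have "\<dots> \<le> s"
    using ops_betweenD(1) [OF A(1), of y] by (simp add: s_def y inner_commute)
  finally have "0 < s" .
  have "N h = R y"
    using y cancel(2) [of "R y"] cancel(3) [of y] by simp
  then have "inner (N h) (N h) = inner y h"
    using sa_opsD [OF sa(1), of y "N h"] cancel(1) [of h] by simp
  then have "(norm (N h))\<^sup>2 = s"
    by (simp add: s_def power2_norm_eq_inner)
  then have PP: "P o\<^sub>L P = P" and P: "P \<in> sa_ops"
    using \<open>0 < s\<close> rank_one_compose_self [of "N h"]
    by (simp_all add: P_def sa_ops_scaleR rank_one_sa
        bounded_bilinear.scaleR_left [OF bounded_bilinear_blinfun_compose]
        bounded_bilinear.scaleR_right [OF bounded_bilinear_blinfun_compose])
  have "N o\<^sub>L (b *\<^sub>R rank_one h) o\<^sub>L N = b *\<^sub>R rank_one (N h)"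
    unfolding rank_one_conjugate [OF sa(2), symmetric]
    by (simp add: bounded_bilinear.scaleR_left [OF bounded_bilinear_blinfun_compose]
        bounded_bilinear.scaleR_right [OF bounded_bilinear_blinfun_compose])
  also have "\<dots> = (b * s) *\<^sub>R P + 0 *\<^sub>R (id_blinfun - P)"
    using \<open>0 < s\<close> by (simp add: P_def)
  finally have "fun_calc ?f (N o\<^sub>L (b *\<^sub>R rank_one h) o\<^sub>L N) = fun_calc ?f \<dots>"
    by simp
  also have "\<dots> = ?f (b * s) *\<^sub>R P + ?f 0 *\<^sub>R (id_blinfun - P)"
  proof (rule fun_calc_projection_combination [OF P PP])
    show "continuous_on {0..b * s} ?f"
      using continuous_on_power_mean_fun [OF \<open>r \<noteq> 0\<close>] by (rule continuous_on_subset) simp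
  qed (use \<open>0 < s\<close> \<open>0 \<le> b\<close> in auto)
  also have "\<dots> = ?f 0 *\<^sub>R id_blinfun + ((?f (b * s) - ?f 0) / s) *\<^sub>R rank_one (N h)"
    by (simp add: P_def algebra_simps diff_divide_distrib)
  finally have "kubo_ando_core r A (b *\<^sub>R rank_one h)
      = R o\<^sub>L (?f 0 *\<^sub>R id_blinfun + ((?f (b * s) - ?f 0) / s) *\<^sub>R rank_one (N h)) o\<^sub>L R"
    unfolding kubo_ando_core_def R_def [symmetric] N_def [symmetric] by simp
  also have "\<dots> = ?f 0 *\<^sub>R A + ((?f (b * s) - ?f 0) / s) *\<^sub>R (R o\<^sub>L rank_one (N h) o\<^sub>L R)"
    by (rule blinfun_eqI)
      (simp add: blinfun.add_left blinfun.scaleR_left blinfun.add_right blinfun.scaleR_right cancel)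
  also have "R o\<^sub>L rank_one (N h) o\<^sub>L R = rank_one h"
    by (simp add: rank_one_conjugate [OF sa(1)] cancel)
  also have "kubo_ando_core r A (b *\<^sub>R rank_one h) = kubo_ando_power_mean r A (b *\<^sub>R rank_one h)"
    using ops_between_scaleR [OF pos_ops_between [OF rank_one_pos] \<open>0 \<le> b\<close>]
    by (intro kubo_ando_power_mean_invertible [symmetric, OF A _ \<open>r \<noteq> 0\<close>] ops_between_pos) auto
  finally show ?thesis .
qed

subsection \<open>The harmonic mean of positive operators\<close>

definition harmonic_form ::
    "('a::complex_hilbert_space \<Rightarrow>\<^sub>L 'a) \<Rightarrow> ('a \<Rightarrow>\<^sub>L 'a) \<Rightarrow> 'a \<Rightarrow> 'a \<Rightarrow> real" where
  "harmonic_form A B x y = 2 * inner (A y) y + 2 * inner (B (x - y)) (x - y)"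

lemma harmonic_form_add_id:
  "harmonic_form (A + \<epsilon> *\<^sub>R id_blinfun) (B + \<epsilon> *\<^sub>R id_blinfun) x y
    = harmonic_form A B x y + 2 * \<epsilon> * ((norm y)\<^sup>2 + (norm (x - y))\<^sup>2)"
  by (simp add: harmonic_form_def blinfun.add_left blinfun.scaleR_left inner_add_left
      power2_norm_eq_inner algebra_simps)

text \<open>Completing the square: at the critical point \<open>y\<^sub>0\<close> both A
  \<open>y\<^sub>0\<close> and B(x - \<open>y\<^sub>0\<close>) equal Hx/2, so the form there is that
  of H, and a displacement v adds twice the forms of A and B at v.\<close>

lemma kubo_ando_core_harmonic:
  assumes A: "A \<in> ops_between c M" "0 < c" and B: "B \<in> ops_between d D" "0 < d"
  defines "H \<equiv> kubo_ando_core (-1) A B"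
  shows "H \<in> sa_ops" "inner (H x) x \<le> harmonic_form A B x y"
    and "\<exists>y. inner (H x) x = harmonic_form A B x y"
proof -
  define R where "R = A opowr (1/2)"
  define N where "N = A opowr (-1/2)"
  define X where "X = N o\<^sub>L B o\<^sub>L N"
  define K where "K = fun_calc (power_mean_fun (-1)) X"
  have sa: "R \<in> sa_ops" "N \<in> sa_ops" "A \<in> sa_ops" "B \<in> sa_ops"
    unfolding R_def N_def using A B by (auto intro: opowr_sa ops_between_sa)
  have cancel: "R (N z) = z" "N (R z) = z" "R (R z) = A z" for z
    unfolding R_def N_def by (rule opowr_half_cancel [OF A])+
  obtain l u where "0 < l" and X: "X \<in> ops_between l u"
    using conjugate_coercive [OF A B] unfolding X_def N_def by blast
  have f: "continuous_on {l..u} (power_mean_fun (-1))"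
    using \<open>0 < l\<close> by (intro continuous_on_subset [OF continuous_on_power_mean_fun]) auto
  have K: "K \<in> sa_ops"
    unfolding K_def by (rule fun_calc_sa [OF X f])
  have H: "H z = R (K (R z))" for z
    unfolding H_def K_def X_def R_def N_def kubo_ando_core_def by simp
  have "H = R o\<^sub>L K o\<^sub>L R"
    by (rule blinfun_eqI) (simp add: H)
  then show "H \<in> sa_ops"
    using sa_ops_conjugate [OF sa(1) K] by simp
  \<comment> \<open>The function f(t) = 2t/(1 + t) satisfies f + t f = 2t. Its operator version K +
    XK = 2X yields B(x - \<open>y\<^sub>0\<close>) = Hx/2 without inverting I + X.\<close>
  have "fun_calc (\<lambda>t. power_mean_fun (-1) t + t * power_mean_fun (-1) t) X = fun_calc (\<lambda>t. 2 * t) X"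
  proof (rule fun_calc_cong [OF X])
    show "power_mean_fun (-1) t + t * power_mean_fun (-1) t = 2 * t" if "t \<in> {l..u}" for t
    proof -
      have "0 < t"
        using that \<open>0 < l\<close> by simp
      then have "power_mean_fun (-1) t = 2 * t / (1 + t)"
        using power_mean_fun_minus' [of 1 t] by (simp add: power_mean_fun_def)
      moreover have "power_mean_fun (-1) t + t * power_mean_fun (-1) t = (1 + t) * power_mean_fun (-1) t"
        by (simp add: distrib_right)
      ultimately show ?thesis
        using \<open>0 < t\<close> by simp
    qed
  qed (intro continuous_intros f)
  then have "K + (X o\<^sub>L K) = 2 *\<^sub>R X"
    unfolding fun_calc_add [OF X f continuous_on_mult [OF continuous_on_id f]]
      fun_calc_mult [OF X continuous_on_id f] fun_calc_scaleR [OF X continuous_on_id]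
      fun_calc_id [OF X] K_def [symmetric] .
  then have "(K + (X o\<^sub>L K)) z = (2 *\<^sub>R X) z" for z
    by (rule arg_cong)
  then have XK: "K z + X (K z) = 2 *\<^sub>R X z" for z
    by (simp add: blinfun.add_left blinfun.scaleR_left)
  have RXR: "R (X (R z)) = B z" for z
    by (simp add: X_def cancel)
  \<comment> \<open>Solves A \<open>y\<^sub>0\<close> = Hx/2: the inverse of A applied to Hx is
    N(K(Rx)).\<close>
  define y\<^sub>0 where "y\<^sub>0 = (1/2) *\<^sub>R N (K (R x))"
  have Ay: "A y\<^sub>0 = (1/2) *\<^sub>R H x"
    unfolding y\<^sub>0_def H by (simp add: blinfun.scaleR_right cancel(3) [symmetric] cancel(1))
  have "B (x - y\<^sub>0) = R (X (R x)) - (1/2) *\<^sub>R R (X (K (R x)))"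
    by (simp add: RXR [symmetric] y\<^sub>0_def blinfun.diff_right blinfun.scaleR_right cancel)
  also have "\<dots> = (1/2) *\<^sub>R R (2 *\<^sub>R X (R x) - X (K (R x)))"
    by (simp add: blinfun.diff_right blinfun.scaleR_right scaleR_diff_right)
  also have "2 *\<^sub>R X (R x) - X (K (R x)) = K (R x)"
    by (simp add: XK [symmetric])
  finally have By: "B (x - y\<^sub>0) = (1/2) *\<^sub>R H x"
    by (simp add: H)
  have eq: "harmonic_form A B x y
      = inner (H x) x + 2 * inner (A (y - y\<^sub>0)) (y - y\<^sub>0) + 2 * inner (B (y - y\<^sub>0)) (y - y\<^sub>0)" for y
  proof -
    define v where "v = y - y\<^sub>0"
    have y: "y = y\<^sub>0 + v" "x - y = (x - y\<^sub>0) - v"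
      by (simp_all add: v_def)
    have "inner (A y) y = inner (A y\<^sub>0) y\<^sub>0 + 2 * inner (A y\<^sub>0) v + inner (A v) v"
      using sa_opsD [OF sa(3), of v y\<^sub>0]
      by (simp add: y(1) blinfun.add_right inner_add inner_commute)
    moreover have "inner (B (x - y)) (x - y)
        = inner (B (x - y\<^sub>0)) (x - y\<^sub>0) - 2 * inner (B (x - y\<^sub>0)) v + inner (B v) v"
      using sa_opsD [OF sa(4), of v "x - y\<^sub>0"]
      unfolding y(2) blinfun.diff_right [of B "x - y\<^sub>0"] inner_diff
      by (simp add: inner_commute)
    ultimately show ?thesis
      unfolding harmonic_form_def Ay By v_def [symmetric]
      by (simp add: inner_diff_right algebra_simps)
  qed
  have "A \<in> pos_ops" "B \<in> pos_ops"
    using A B by (auto intro: ops_between_pos)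
  then show "inner (H x) x \<le> harmonic_form A B x y"
    unfolding eq by (simp add: pos_ops_iff)
  show "\<exists>y. inner (H x) x = harmonic_form A B x y"
    by (rule exI [of _ y\<^sub>0]) (simp add: eq)
qed

text \<open>The forms decrease and are bounded below, hence converge. Differences of the net lie
  between 0 and C, so \<open>ops_between_norm_sq_le\<close> makes the vectors Cauchy.\<close>

lemma monotone_strong_limit:
  fixes H :: "real \<Rightarrow> 'a::complex_hilbert_space \<Rightarrow>\<^sub>L 'a"
  assumes H: "\<And>\<epsilon>. 0 < \<epsilon> \<Longrightarrow> \<epsilon> \<le> 1 \<Longrightarrow> H \<epsilon> \<in> ops_between 0 C" and "0 < C"
    and mono: "\<And>\<epsilon> \<delta> x. 0 < \<epsilon> \<Longrightarrow> \<epsilon> \<le> \<delta> \<Longrightarrow> \<delta> \<le> 1 \<Longrightarrow> inner (H \<epsilon> x) x \<le> inner (H \<delta> x) x"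
  shows "\<exists>T \<in> pos_ops. \<forall>x. ((\<lambda>\<epsilon>. H \<epsilon> x) \<longlongrightarrow> T x) (at_right 0)"
proof -
  have "\<exists>l. ((\<lambda>\<epsilon>. H \<epsilon> x) \<longlongrightarrow> l) (at_right 0)" for x
  proof -
    define m where "m = (INF \<epsilon>\<in>{0<..1}. inner (H \<epsilon> x) x)"
    have bdd: "bdd_below ((\<lambda>\<epsilon>. inner (H \<epsilon> x) x) ` {0<..1})"
      using ops_betweenD(1) [OF H] by (intro bdd_belowI [of _ 0]) force
    have m: "m \<le> inner (H \<epsilon> x) x" if "0 < \<epsilon>" "\<epsilon> \<le> 1" for \<epsilon>
      unfolding m_def using that by (intro cINF_lower bdd) auto
    have near: "\<exists>\<delta>>0. \<forall>\<epsilon> \<epsilon>'. 0 < \<epsilon> \<and> \<epsilon> \<le> \<delta> \<and> 0 < \<epsilon>' \<and> \<epsilon>' \<le> \<delta> \<longrightarrow> dist (H \<epsilon> x) (H \<epsilon>' x) < e"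
      if "0 < e" for e
    proof -
      \<comment> \<open>The tolerance is chosen so that the factor C in the bound for the squared
        distance leaves exactly e^2.\<close>
      have "0 < e\<^sup>2 / C"
        using that \<open>0 < C\<close> by simp
      then have "m < m + e\<^sup>2 / C"
        by simp
      moreover have "{0<..1 :: real} \<noteq> {}"
        by simp
      ultimately have "\<exists>\<delta>\<in>{0<..1}. inner (H \<delta> x) x < m + e\<^sup>2 / C"
        using cINF_less_iff [OF _ bdd, folded m_def] by blast
      then obtain \<delta> where \<delta>: "0 < \<delta>" "\<delta> \<le> 1" "inner (H \<delta> x) x < m + e\<^sup>2 / C"
        by auto
      have ordered: "dist (H \<epsilon> x) (H \<epsilon>' x) < e" if "0 < \<epsilon>" "\<epsilon> \<le> \<epsilon>'" "\<epsilon>' \<le> \<delta>" for \<epsilon> \<epsilon>'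
      proof -
        have "\<epsilon>' \<le> 1" "\<epsilon> \<le> 1"
          using that \<delta> by auto
        have "H \<epsilon>' - H \<epsilon> \<in> ops_between 0 C"
        proof -
          have "inner (H \<epsilon>' z) z - inner (H \<epsilon> z) z \<le> C * (norm z)\<^sup>2" for z
            using ops_betweenD [OF H [of \<epsilon>], of z] ops_betweenD [OF H [of \<epsilon>'], of z] that \<open>\<epsilon>' \<le> 1\<close> by auto
          then show ?thesis
            using H [of \<epsilon>] H [of \<epsilon>'] mono [of \<epsilon> \<epsilon>'] that \<open>\<epsilon>' \<le> 1\<close>
            by (simp add: ops_between_def sa_ops_diff blinfun.diff_left inner_diff_left)
        qed
        then have "(norm ((H \<epsilon>' - H \<epsilon>) x))\<^sup>2 \<le> C * inner ((H \<epsilon>' - H \<epsilon>) x) x"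
          using \<open>0 < C\<close> by (rule ops_between_norm_sq_le)
        also have "inner ((H \<epsilon>' - H \<epsilon>) x) x < e\<^sup>2 / C"
          using mono [of \<epsilon>' \<delta> x] m [of \<epsilon>] \<delta> that
          by (simp add: blinfun.diff_left inner_diff_left)
        then have "C * inner ((H \<epsilon>' - H \<epsilon>) x) x < e\<^sup>2"
          using \<open>0 < C\<close> by (simp add: pos_less_divide_eq mult.commute)
        finally have "norm ((H \<epsilon>' - H \<epsilon>) x) < e"
          using \<open>0 < e\<close> by (simp add: power2_less_imp_less)
        then show ?thesis
          by (simp add: dist_norm blinfun.diff_left norm_minus_commute)
      qed
      show ?thesis
        using ordered \<delta>(1) by (metis dist_commute linear)
    qed
    \<comment> \<open>A sequence tending to 0 provides a candidate limit by completeness; the Cauchy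
      estimate then extends convergence to the whole net.\<close>
    define s where "s n = inverse (real (Suc n))" for n
    have s: "0 < s n" for n
      by (simp add: s_def)
    have small: "\<exists>N. \<forall>n\<ge>N. s n \<le> \<delta>" if "0 < \<delta>" for \<delta>
      using order_tendstoD(2) [OF LIMSEQ_inverse_real_of_nat that]
      unfolding eventually_sequentially s_def by (meson less_imp_le)
    have "Cauchy (\<lambda>n. H (s n) x)"
    proof (rule metric_CauchyI)
      fix e :: real
      assume "0 < e"
      then obtain \<delta> where "0 < \<delta>"
        and \<delta>: "\<And>\<epsilon> \<epsilon>'. 0 < \<epsilon> \<Longrightarrow> \<epsilon> \<le> \<delta> \<Longrightarrow> 0 < \<epsilon>' \<Longrightarrow> \<epsilon>' \<le> \<delta> \<Longrightarrow> dist (H \<epsilon> x) (H \<epsilon>' x) < e"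
        using near by metis
      then show "\<exists>N. \<forall>m\<ge>N. \<forall>n\<ge>N. dist (H (s m) x) (H (s n) x) < e"
        using small [OF \<open>0 < \<delta>\<close>] s by metis
    qed
    then obtain l where l: "(\<lambda>n. H (s n) x) \<longlonglongrightarrow> l"
      using Cauchy_convergent convergent_def by blast
    have "((\<lambda>\<epsilon>. H \<epsilon> x) \<longlongrightarrow> l) (at_right 0)"
    proof (rule tendstoI)
      fix e :: real
      assume "0 < e"
      then have "0 < e / 2"
        by simp
      then obtain \<delta> where "0 < \<delta>"
        and \<delta>: "\<And>\<epsilon> \<epsilon>'. 0 < \<epsilon> \<Longrightarrow> \<epsilon> \<le> \<delta> \<Longrightarrow> 0 < \<epsilon>' \<Longrightarrow> \<epsilon>' \<le> \<delta> \<Longrightarrow> dist (H \<epsilon> x) (H \<epsilon>' x) < e / 2"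
        using near by metis
      obtain N where N: "\<And>n. n \<ge> N \<Longrightarrow> s n \<le> \<delta>"
        using small [OF \<open>0 < \<delta>\<close>] by blast
      have "\<forall>\<^sub>F \<epsilon> in at_right 0. 0 < \<epsilon> \<and> \<epsilon> < \<delta>"
        using eventually_at_right_real [OF \<open>0 < \<delta>\<close>] by (simp add: greaterThanLessThan_def)
      then show "\<forall>\<^sub>F \<epsilon> in at_right 0. dist (H \<epsilon> x) l < e"
      proof eventually_elim
        case (elim \<epsilon>)
        have "dist (H \<epsilon> x) l \<le> e / 2"
        proof (rule tendsto_upperbound [OF tendsto_dist [OF tendsto_const l]])
          show "\<forall>\<^sub>F n in sequentially. dist (H \<epsilon> x) (H (s n) x) \<le> e / 2"
            unfolding eventually_sequentially
            using N \<delta> [of \<epsilon>] elim s by (intro exI [of _ N]) (auto intro: less_imp_le)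
        qed simp
        then show ?case
          using \<open>0 < e\<close> by simp
      qed
    qed
    then show ?thesis
      by blast
  qed
  then obtain L where L: "\<And>x. ((\<lambda>\<epsilon>. H \<epsilon> x) \<longlongrightarrow> L x) (at_right 0)"
    by metis
  note unique = tendsto_unique [OF trivial_limit_at_right_real L]
  have "bounded_linear L"
  proof (rule bounded_linear_intro)
    show "L (x + y) = L x + L y" for x y
      by (rule unique) (simp add: blinfun.add_right tendsto_add L)
    show "L (r *\<^sub>R x) = r *\<^sub>R L x" for r x
      by (rule unique) (simp add: blinfun.scaleR_right tendsto_scaleR L)
    show "norm (L x) \<le> norm x * C" for x
    proof (rule tendsto_upperbound [OF tendsto_norm [OF L]])
      show "\<forall>\<^sub>F \<epsilon> in at_right 0. norm (H \<epsilon> x) \<le> norm x * C"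
        using eventually_at_right_unit
      proof eventually_elim
        case (elim \<epsilon>)
        then have "norm (H \<epsilon>) \<le> C"
          using ops_between_norm_le [OF H \<open>0 < C\<close>] by simp
        then show ?case
          using norm_blinfun [of "H \<epsilon>" x] mult_right_mono [of "norm (H \<epsilon>)" C "norm x"]
          by (simp add: mult.commute)
      qed
    qed simp
  qed
  then have T: "blinfun_apply (Blinfun L) = L"
    by (rule bounded_linear_Blinfun_apply)
  have ev: "\<forall>\<^sub>F \<epsilon> in at_right 0. H \<epsilon> \<in> ops_between 0 C"
    using eventually_at_right_unit by eventually_elim (use H in auto)
  have "Blinfun L \<in> sa_ops"
  proof (rule sa_ops_strong_limit [OF trivial_limit_at_right_real])
    show "\<forall>\<^sub>F \<epsilon> in at_right 0. H \<epsilon> \<in> sa_ops"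
      using ev by eventually_elim (rule ops_between_sa)
  qed (simp add: T L)
  moreover have "0 \<le> inner (L x) x" for x
  proof (rule tendsto_lowerbound [OF tendsto_inner [OF L tendsto_const]])
    show "\<forall>\<^sub>F \<epsilon> in at_right 0. 0 \<le> inner (H \<epsilon> x) x"
      using ev
    proof eventually_elim
      case (elim \<epsilon>)
      then show ?case
        using ops_betweenD(1) [OF elim, of x] by simp
    qed
  qed simp
  ultimately show ?thesis
    using L by (intro bexI [of _ "Blinfun L"]) (auto simp: T pos_ops_iff)
qed

text \<open>The regularized means have minimizers, but these may escape as \<epsilon> tends to 0.
  Hence the limit keeps the upper bound for every y together with approximate attainment, and these
  express the infimum.\<close>

lemma harmonic_mean_variational:
  assumes A: "A \<in> pos_ops" and B: "B \<in> pos_ops"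
  defines "T \<equiv> kubo_ando_power_mean (-1) A B"
  shows "T \<in> pos_ops" "inner (T x) x \<le> harmonic_form A B x y"
    and "0 < e \<Longrightarrow> \<exists>y. harmonic_form A B x y \<le> inner (T x) x + e"
proof -
  define A' where "A' \<epsilon> = A + \<epsilon> *\<^sub>R id_blinfun" for \<epsilon>
  define B' where "B' \<epsilon> = B + \<epsilon> *\<^sub>R id_blinfun" for \<epsilon>
  define H where "H \<epsilon> = kubo_ando_mean_inv (-1) (A' \<epsilon>) (B' \<epsilon>)" for \<epsilon>
  \<comment> \<open>The uniform bound comes from the competitor y = 0, whose form is twice that of
    the regularized B.\<close>
  define C where "C = 2 * (norm B + 1)"
  have A': "A' \<epsilon> \<in> ops_between \<epsilon> (norm A + \<epsilon>)" and B': "B' \<epsilon> \<in> ops_between \<epsilon> (norm B + \<epsilon>)"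
    if "0 < \<epsilon>" for \<epsilon>
    using that ops_between_add_id [OF pos_ops_between [OF A], of \<epsilon>]
      ops_between_add_id [OF pos_ops_between [OF B], of \<epsilon>]
    by (simp_all add: A'_def B'_def)
  have core: "H \<epsilon> = kubo_ando_core (-1) (A' \<epsilon>) (B' \<epsilon>)" if "0 < \<epsilon>" for \<epsilon>
    unfolding H_def using A' B' that by (intro kubo_ando_mean_inv_eq) auto
  have H: "H \<epsilon> \<in> sa_ops" "inner (H \<epsilon> x) x \<le> harmonic_form (A' \<epsilon>) (B' \<epsilon>) x y"
      "\<exists>y. inner (H \<epsilon> x) x = harmonic_form (A' \<epsilon>) (B' \<epsilon>) x y" if "0 < \<epsilon>" for \<epsilon> x y
    unfolding core [OF that] by (rule kubo_ando_core_harmonic [OF A' [OF that] that B' [OF that] that])+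
  have form: "harmonic_form (A' \<epsilon>) (B' \<epsilon>) x y
      = harmonic_form A B x y + 2 * \<epsilon> * ((norm y)\<^sup>2 + (norm (x - y))\<^sup>2)" for \<epsilon> x y
    unfolding A'_def B'_def by (rule harmonic_form_add_id)
  have nonneg: "0 \<le> harmonic_form A B x y" for x y
    using A B by (simp add: harmonic_form_def pos_ops_iff)
  have "\<exists>T \<in> pos_ops. \<forall>x. ((\<lambda>\<epsilon>. H \<epsilon> x) \<longlongrightarrow> T x) (at_right 0)"
  proof (rule monotone_strong_limit)
    show "0 < C"
      by (simp add: C_def add_nonneg_pos)
    show "inner (H \<epsilon> x) x \<le> inner (H \<delta> x) x" if "0 < \<epsilon>" "\<epsilon> \<le> \<delta>" "\<delta> \<le> 1" for \<epsilon> \<delta> x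
    proof -
      have "0 < \<delta>"
        using that by simp
      \<comment> \<open>The minimizer for \<delta> competes in the problem for \<epsilon>, whose
        form is no larger.\<close>
      obtain y where "inner (H \<delta> x) x = harmonic_form (A' \<delta>) (B' \<delta>) x y"
        using H(3) [OF \<open>0 < \<delta>\<close>] by blast
      moreover have "harmonic_form (A' \<epsilon>) (B' \<epsilon>) x y \<le> harmonic_form (A' \<delta>) (B' \<delta>) x y"
        unfolding form using that by (intro add_left_mono mult_right_mono) auto
      ultimately show ?thesis
        using H(2) [OF that(1), of x y] by simp
    qed
    show "H \<epsilon> \<in> ops_between 0 C" if "0 < \<epsilon>" "\<epsilon> \<le> 1" for \<epsilon>
    proof -
      have "0 \<le> inner (H \<epsilon> x) x \<and> inner (H \<epsilon> x) x \<le> C * (norm x)\<^sup>2" for x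
      proof
        obtain y where "inner (H \<epsilon> x) x = harmonic_form (A' \<epsilon>) (B' \<epsilon>) x y"
          using H(3) [OF \<open>0 < \<epsilon>\<close>] by blast
        then show "0 \<le> inner (H \<epsilon> x) x"
          using nonneg [of x y] that(1) by (simp add: form)
        have "inner (H \<epsilon> x) x \<le> harmonic_form (A' \<epsilon>) (B' \<epsilon>) x 0"
          using that(1) by (rule H(2))
        also have "\<dots> = 2 * inner (B' \<epsilon> x) x"
          by (simp add: harmonic_form_def)
        also have "\<dots> \<le> 2 * ((norm B + \<epsilon>) * (norm x)\<^sup>2)"
          using ops_betweenD(2) [OF B' [OF that(1)]] by simp
        also have "\<dots> \<le> 2 * ((norm B + 1) * (norm x)\<^sup>2)"
          using that(2) by (simp add: mult_right_mono)
        finally show "inner (H \<epsilon> x) x \<le> C * (norm x)\<^sup>2"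
          by (simp only: C_def mult.assoc)
      qed
      then show ?thesis
        using H(1) [OF that(1)] by (simp add: ops_between_def)
    qed
  qed
  then obtain S where S: "S \<in> pos_ops" "\<And>x. ((\<lambda>\<epsilon>. H \<epsilon> x) \<longlongrightarrow> S x) (at_right 0)"
    by blast
  have "T = S"
    unfolding T_def using S(2) unfolding H_def A'_def B'_def by (rule kubo_ando_power_mean_eqI)
  then show "T \<in> pos_ops"
    using S(1) by simp
  have lim: "((\<lambda>\<epsilon>. inner (H \<epsilon> x) x) \<longlongrightarrow> inner (T x) x) (at_right 0)" for x
    unfolding \<open>T = S\<close> by (intro tendsto_inner S(2) tendsto_const)
  show "inner (T x) x \<le> harmonic_form A B x y"
  proof (rule tendsto_le [OF trivial_limit_at_right_real _ lim])
    have "((\<lambda>\<epsilon>. harmonic_form A B x y + 2 * \<epsilon> * ((norm y)\<^sup>2 + (norm (x - y))\<^sup>2))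
        \<longlongrightarrow> harmonic_form A B x y + 2 * 0 * ((norm y)\<^sup>2 + (norm (x - y))\<^sup>2)) (at_right 0)"
      by (intro tendsto_add tendsto_mult tendsto_const tendsto_ident_at)
    then show "((\<lambda>\<epsilon>. harmonic_form (A' \<epsilon>) (B' \<epsilon>) x y) \<longlongrightarrow> harmonic_form A B x y) (at_right 0)"
      by (simp add: form)
    show "\<forall>\<^sub>F \<epsilon> in at_right 0. inner (H \<epsilon> x) x \<le> harmonic_form (A' \<epsilon>) (B' \<epsilon>) x y"
      using eventually_at_right_unit by eventually_elim (use H(2) in auto)
  qed
  show "\<exists>y. harmonic_form A B x y \<le> inner (T x) x + e" if "0 < e"
  proof -
    have "\<forall>\<^sub>F \<epsilon> in at_right 0. inner (H \<epsilon> x) x < inner (T x) x + e"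
      using order_tendstoD(2) [OF lim] that by simp
    then have "\<forall>\<^sub>F \<epsilon> in at_right 0. 0 < \<epsilon> \<and> inner (H \<epsilon> x) x < inner (T x) x + e"
      using eventually_at_right_unit by eventually_elim auto
    then obtain \<epsilon> where \<epsilon>: "0 < \<epsilon>" "inner (H \<epsilon> x) x < inner (T x) x + e"
      using eventually_happens' trivial_limit_at_right_real by blast
    \<comment> \<open>The exact minimizer of a problem with small \<epsilon> is an approximate one
      for A and B, since removing the nonnegative \<epsilon>-term only lowers the form.\<close>
    obtain y where "inner (H \<epsilon> x) x = harmonic_form (A' \<epsilon>) (B' \<epsilon>) x y"
      using H(3) [OF \<epsilon>(1)] by blast
    then have "harmonic_form A B x y \<le> inner (H \<epsilon> x) x"
      using \<epsilon>(1) by (simp add: form)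
    then show ?thesis
      using \<epsilon>(2) by (intro exI [of _ y]) simp
  qed
qed

text \<open>Both sides have as form the infimum, over decompositions x = a + b + c + d, of four
  times the sum of the forms of A, B, C, D at a, b, c, d. Only the grouping of the summands differs.
  One inequality is enough, because exchanging B and C reverses it.\<close>

lemma harmonic_mean_bisymmetric:
  fixes A B C D :: "'a::complex_hilbert_space \<Rightarrow>\<^sub>L 'a"
  assumes pos: "A \<in> pos_ops" "B \<in> pos_ops" "C \<in> pos_ops" "D \<in> pos_ops"
  defines "h \<equiv> kubo_ando_power_mean (-1) :: ('a \<Rightarrow>\<^sub>L 'a) \<Rightarrow> ('a \<Rightarrow>\<^sub>L 'a) \<Rightarrow> ('a \<Rightarrow>\<^sub>L 'a)"
  shows "h (h A B) (h C D) = h (h A C) (h B D)"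
proof -
  have le: "inner (h (h A B) (h C D) x) x \<le> inner (h (h A C) (h B D) x) x"
    if pos: "A \<in> pos_ops" "B \<in> pos_ops" "C \<in> pos_ops" "D \<in> pos_ops" for A B C D x
  proof (rule field_le_epsilon)
    fix e :: real
    assume "0 < e"
    \<comment> \<open>One share is lost in the outer problem; each of the two inner errors is
      doubled by the outer form, which accounts for the other four.\<close>
    then have e: "0 < e / 5"
      by simp
    note hpos = harmonic_mean_variational(1) [where 'a = 'a, folded h_def]
      and upper = harmonic_mean_variational(2) [where 'a = 'a, folded h_def]
      and approx = harmonic_mean_variational(3) [where 'a = 'a, folded h_def, OF _ _ e]
    obtain y where y: "harmonic_form (h A C) (h B D) x y \<le> inner (h (h A C) (h B D) x) x + e / 5"
      using approx [OF hpos [OF pos(1,3)] hpos [OF pos(2,4)]] by blast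
    obtain u where u: "harmonic_form A C y u \<le> inner (h A C y) y + e / 5"
      using approx [OF pos(1,3)] by blast
    obtain v where v: "harmonic_form B D (x - y) v \<le> inner (h B D (x - y)) (x - y) + e / 5"
      using approx [OF pos(2,4)] by blast
    have eqs: "u + v - u = v" "x - (u + v) - (y - u) = x - y - v"
      by simp_all
    \<comment> \<open>The four summands of x are u, v, y - u, x - y - v, belonging to A, B, C, D.
      The other side splits x into u + v and the rest.\<close>
    have "inner (h (h A B) (h C D) x) x \<le> harmonic_form (h A B) (h C D) x (u + v)"
      by (intro upper hpos pos)
    also have "\<dots> \<le> 2 * harmonic_form A B (u + v) u + 2 * harmonic_form C D (x - (u + v)) (y - u)"
      using upper [OF pos(1,2), of "u + v" u] upper [OF pos(3,4), of "x - (u + v)" "y - u"]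
      unfolding harmonic_form_def [of "h A B"] by linarith
    also have "\<dots> = 2 * harmonic_form A C y u + 2 * harmonic_form B D (x - y) v"
      unfolding harmonic_form_def eqs by simp
    also have "\<dots> \<le> harmonic_form (h A C) (h B D) x y + 4 * (e / 5)"
      using u v unfolding harmonic_form_def [of "h A C"] by linarith
    finally show "inner (h (h A B) (h C D) x) x \<le> inner (h (h A C) (h B D) x) x + e"
      using y by linarith
  qed
  have sa: "h (h A B) (h C D) \<in> sa_ops" if "A \<in> pos_ops" "B \<in> pos_ops" "C \<in> pos_ops" "D \<in> pos_ops" for A B C D
  proof -
    note hpos = harmonic_mean_variational(1) [where 'a = 'a, folded h_def]
    have "h (h A B) (h C D) \<in> pos_ops"
      by (rule hpos [OF hpos [OF that(1,2)] hpos [OF that(3,4)]])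
    then show ?thesis
      by (simp add: pos_ops_iff)
  qed
  show ?thesis
  proof (rule sa_ops_eqI)
    show "inner (h (h A B) (h C D) x) x = inner (h (h A C) (h B D) x) x" for x
      using le [OF pos] le [OF pos(1,3,2,4)] by (rule antisym)
  qed (rule sa [OF pos] sa [OF pos(1,3,2,4)])+
qed

subsection \<open>Bisymmetry of the conventional power mean\<close>

lemma conventional_power_mean_pos:
  assumes "A \<in> pos_ops" "B \<in> pos_ops" "p \<noteq> 0"
  shows "conventional_power_mean p A B \<in> pos_ops"
proof (cases "0 < p")
  case True
  have "S + T \<in> pos_ops \<and> (1/2) *\<^sub>R S \<in> pos_ops" if "S \<in> pos_ops" "T \<in> pos_ops" for S T :: "'a \<Rightarrow>\<^sub>L 'a"
    using that by (simp add: pos_ops_iff sa_ops_add sa_ops_scaleR blinfun.add_left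
        blinfun.scaleR_left inner_add_left)
  then show ?thesis
    using assms True by (auto simp: conventional_power_mean_def intro!: opowr_pos)
next
  case False
  then show ?thesis
    using assms by (auto simp: conventional_power_mean_def intro!: opowr_pos harmonic_mean_variational(1))
qed

lemma conventional_power_mean_bisymmetric:
  assumes pos: "A \<in> pos_ops" "B \<in> pos_ops" "C \<in> pos_ops" "D \<in> pos_ops" and "p \<noteq> 0"
  defines "m \<equiv> conventional_power_mean p"
  shows "m (m A B) (m C D) = m (m A C) (m B D)"
proof (cases "0 < p")
  case True
  have m: "m S T = ((1/2) *\<^sub>R (S opowr p + T opowr p)) opowr (1/p)" for S T
    using True by (simp add: m_def conventional_power_mean_def)
  have "(m S T) opowr p = (1/2) *\<^sub>R (S opowr p + T opowr p)" if "S \<in> pos_ops" "T \<in> pos_ops" for S T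
    unfolding m
  proof (rule opowr_opowr_inverse)
    show "(1/2) *\<^sub>R (S opowr p + T opowr p) \<in> pos_ops"
      using opowr_pos [OF that(1) True] opowr_pos [OF that(2) True]
      by (simp add: pos_ops_iff sa_ops_add sa_ops_scaleR blinfun.add_left blinfun.scaleR_left
          inner_add_left)
  qed (use True in auto)
  then show ?thesis
    unfolding m [of "m _ _"] using pos by (simp add: scaleR_add_right add_ac)
next
  case False
  then have "0 < - p"
    using assms by simp
  let ?h = "kubo_ando_power_mean (-1)"
  have m: "m S T = (?h (S opowr (-p)) (T opowr (-p))) opowr (1/(-p))" for S T
    using False by (simp add: m_def conventional_power_mean_def)
  have "(m S T) opowr (-p) = ?h (S opowr (-p)) (T opowr (-p))" if "S \<in> pos_ops" "T \<in> pos_ops" for S T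
    unfolding m
    by (rule opowr_opowr_inverse)
      (use that \<open>0 < - p\<close> in \<open>auto intro!: harmonic_mean_variational(1) opowr_pos\<close>)
  then show ?thesis
    unfolding m [of "m _ _"] using pos
    by (simp add: harmonic_mean_bisymmetric opowr_pos [OF _ \<open>0 < - p\<close>])
qed

subsection \<open>Failure of bisymmetry for the Kubo--Ando power mean\<close>

text \<open>The vector y in the proof is the inverse of G applied to f. Since f has weight 1/2 on
  each eigenspace of G, s is the plain average of the inverse eigenvalues.\<close>

lemma kubo_ando_power_mean_two_rank_one:
  assumes "norm e = 1" "norm f = 1" "inner (rank_one e f) f = 1 / 2"
    and pos: "0 < a" "0 < b" "0 \<le> c" and "r \<noteq> 0"
  defines "G \<equiv> a *\<^sub>R rank_one e + b *\<^sub>R (id_blinfun - rank_one e)" and "s \<equiv> (1 / a + 1 / b) / 2"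
  shows "kubo_ando_power_mean r G (c *\<^sub>R rank_one f) =
    power_mean_fun r 0 *\<^sub>R G + ((power_mean_fun r (c * s) - power_mean_fun r 0) / s) *\<^sub>R rank_one f"
proof -
  let ?P = "rank_one e"
  define y where "y = (1 / a) *\<^sub>R ?P f + (1 / b) *\<^sub>R (f - ?P f)"
  have P: "?P o\<^sub>L ?P = ?P"
    using assms(1) by (simp add: rank_one_compose_self)
  then have PP: "?P (?P x) = ?P x" for x
    by (metis blinfun_apply_blinfun_compose)
  have "?P y = (1 / a) *\<^sub>R ?P f"
    by (simp add: y_def blinfun.add_right blinfun.diff_right blinfun.scaleR_right PP)
  then have "G y = f"
    using pos(1,2)
    by (simp add: G_def blinfun.add_left blinfun.scaleR_left blinfun.diff_left) (simp add: y_def)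
  have "inner f f = 1"
    using assms(2) by (simp add: norm_eq_1)
  then have s: "inner y f = s"
    using assms(3) by (simp add: y_def s_def inner_add_left inner_diff_left)
  have "G \<in> ops_between (min a b) (max a b)"
    unfolding G_def by (intro projection_combination_between rank_one_sa P) auto
  moreover have "0 < min a b" "f \<noteq> 0"
    using pos assms(2) by auto
  ultimately show ?thesis
    using kubo_ando_power_mean_rank_one [OF _ _ \<open>G y = f\<close> _ pos(3) \<open>r \<noteq> 0\<close>] unfolding s by blast
qed

lemma kubo_ando_power_mean_id_rank_one:
  assumes "norm e = 1" "0 \<le> a" "0 \<le> b" "r \<noteq> 0"
  shows "kubo_ando_power_mean r id_blinfun (a *\<^sub>R rank_one e + b *\<^sub>R (id_blinfun - rank_one e))
    = power_mean_fun r a *\<^sub>R rank_one e + power_mean_fun r b *\<^sub>R (id_blinfun - rank_one e)"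
proof -
  have P: "rank_one e o\<^sub>L rank_one e = rank_one e"
    using assms(1) by (simp add: rank_one_compose_self)
  have "a *\<^sub>R rank_one e + b *\<^sub>R (id_blinfun - rank_one e) \<in> ops_between 0 (max a b)"
    using assms by (intro projection_combination_between rank_one_sa P) auto
  then have "kubo_ando_power_mean r id_blinfun (a *\<^sub>R rank_one e + b *\<^sub>R (id_blinfun - rank_one e))
      = kubo_ando_core r id_blinfun (a *\<^sub>R rank_one e + b *\<^sub>R (id_blinfun - rank_one e))"
    using ops_between_pos
    by (intro kubo_ando_power_mean_invertible [OF ops_between_id _ _ \<open>r \<noteq> 0\<close>]) auto
  then show ?thesis
    using kubo_ando_core_projection_combination [OF rank_one_sa P, of 1 1 a b r] assms by simp
qed

text \<open>Gram-Schmidt applied to two independent vectors gives orthonormal e and g, and f is the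
  normalized sum of e and g.\<close>

lemma ex_half_angle_unit_vectors:
  assumes "\<exists>S :: 'a::complex_hilbert_space set. card S = 2 \<and> complex_vector.independent S"
  obtains e f :: "'a::complex_hilbert_space" where "norm e = 1" "norm f = 1" "(cmod (cinner e f))\<^sup>2 = 1 / 2"
proof -
  obtain v w :: 'a where vw: "v \<noteq> w" "complex_vector.independent {v, w}"
    using assms by (auto simp: card_2_iff)
  then have "v \<noteq> 0"
    using complex_vector.dependent_zero [of "{v, w}"] by auto
  define e where "e = (1 / norm v) *\<^sub>R v"
  have e: "norm e = 1"
    using \<open>v \<noteq> 0\<close> by (simp add: e_def)
  define u where "u = w - cinner w e *\<^sub>C e"
  have "u \<noteq> 0"
  proof
    assume "u = 0"
    then have w: "w = (cinner w e * complex_of_real (1 / norm v)) *\<^sub>C v"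
      by (simp add: u_def e_def scaleR_scaleC scaleC_scaleC)
    have "w \<in> complex_vector.span {v}"
      by (subst w) (intro complex_vector.span_scale complex_vector.span_base singletonI)
    moreover have "w \<notin> complex_vector.span ({v, w} - {w})"
      using vw(2) by (auto simp: complex_vector.dependent_def)
    moreover have "{v, w} - {w} = {v}"
      using vw(1) by auto
    ultimately show False
      by simp
  qed
  define g where "g = (1 / norm u) *\<^sub>R u"
  have g: "norm g = 1"
    using \<open>u \<noteq> 0\<close> by (simp add: g_def)
  have "cinner u e = 0"
    by (simp add: u_def cinner_diff_left cinner_scaleC_left cinner_self e)
  then have ge: "cinner g e = 0"
    by (simp add: g_def scaleR_scaleC cinner_scaleC_left)
  then have eg: "cinner e g = 0"
    by (metis cinner_commute complex_cnj_zero)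
  define f where "f = (1 / sqrt 2) *\<^sub>R (e + g)"
  have "(norm (e + g))\<^sup>2 = 2"
  proof -
    have "inner e e = 1" "inner g g = 1" "inner e g = 0" "inner g e = 0"
      using e g by (simp_all add: norm_eq_1 inner_eq_Re_cinner [of e g] inner_eq_Re_cinner [of g e] eg ge)
    then show ?thesis
      by (simp add: power2_norm_eq_inner inner_add_left inner_add_right)
  qed
  then have "norm (e + g) = sqrt 2"
    by (intro real_sqrt_unique [symmetric]) auto
  then have "norm f = 1"
    by (simp add: f_def)
  moreover have "cinner e f = complex_of_real (1 / sqrt 2)"
    by (simp add: f_def scaleR_scaleC cinner_scaleC_right cinner_add_right cinner_self e eg)
  then have "(cmod (cinner e f))\<^sup>2 = 1 / 2"
    by (simp add: norm_divide power_divide)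
  ultimately show ?thesis
    using that e by blast
qed

text \<open>
  With \<open>P\<close> and \<open>Q\<close> the projections onto \<open>e\<close> and \<open>f\<close>, the bisymmetry equation is tested at
  \<open>(I \<circ> P) \<circ> (Q \<circ> 0)\<close> for \<open>p > 0\<close> and at \<open>(I \<circ> P) \<circ> (B \<circ> P)\<close> with \<open>B = 2Q + (I - Q)\<close> for
  \<open>p < 0\<close>.  Both instances express equality in Jensen's inequality for a strictly concave function.
\<close>

lemma kubo_ando_power_mean_not_bisymmetric:
  fixes p :: real
  assumes p: "-1 < p" "p < 1" "p \<noteq> 0"
    and dim: "\<exists>S :: 'a::complex_hilbert_space set. card S = 2 \<and> complex_vector.independent S"
  defines "m \<equiv> kubo_ando_power_mean p :: ('a \<Rightarrow>\<^sub>L 'a) \<Rightarrow> ('a \<Rightarrow>\<^sub>L 'a) \<Rightarrow> ('a \<Rightarrow>\<^sub>L 'a)"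
  shows "\<exists>X \<in> pos_ops. \<exists>Y \<in> pos_ops. \<exists>Z \<in> pos_ops. \<exists>W \<in> pos_ops.
    m (m X Y) (m Z W) \<noteq> m (m X Z) (m Y W)"
proof -
  obtain e f :: 'a where e: "norm e = 1" and f: "norm f = 1" and ef: "(cmod (cinner e f))\<^sup>2 = 1 / 2"
    using ex_half_angle_unit_vectors [OF dim] .
  define P where "P = rank_one e"
  define Q where "Q = rank_one f"
  have Qe: "inner (Q e) e = 1 / 2"
    using ef by (simp add: Q_def inner_rank_one)
  have "cmod (cinner f e) = cmod (cinner e f)"
    by (metis cinner_commute complex_mod_cnj)
  then have Pf: "inner (P f) f = 1 / 2"
    using ef by (simp add: P_def inner_rank_one)
  have Pe: "inner (P e) e = 1"
    using e by (simp add: P_def inner_rank_one cinner_self)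
  have PP: "P o\<^sub>L P = P" and QQ: "Q o\<^sub>L Q = Q"
    using e f by (simp_all add: P_def Q_def rank_one_compose_self)
  have sa: "P \<in> sa_ops" "Q \<in> sa_ops"
    by (simp_all add: P_def Q_def rank_one_sa)
  have pos: "P \<in> pos_ops" "Q \<in> pos_ops" "id_blinfun \<in> (pos_ops :: ('a \<Rightarrow>\<^sub>L 'a) set)"
    using ops_between_pos [OF ops_between_id] by (simp_all add: P_def Q_def rank_one_pos)
  have pos0: "0 \<in> (pos_ops :: ('a \<Rightarrow>\<^sub>L 'a) set)"
    using sa_ops_scaleR [OF sa(1), of 0] by (simp add: pos_ops_iff)
  let ?k = "power_mean_fun p 0"
  note PQ = kubo_ando_power_mean_two_rank_one [OF e f Pf [unfolded P_def] _ _ _ p(3),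
      folded P_def Q_def m_def]
  note QP = kubo_ando_power_mean_two_rank_one [OF f e Qe [unfolded Q_def] _ _ _ p(3),
      folded P_def Q_def m_def]
  note IP = kubo_ando_power_mean_id_rank_one [OF e _ _ p(3), folded P_def m_def]
  note IQ = kubo_ando_power_mean_id_rank_one [OF f _ _ p(3), folded Q_def m_def]
  have mP: "m P (b *\<^sub>R P) = power_mean_fun p b *\<^sub>R P" if "0 \<le> b" for b
    unfolding m_def by (rule kubo_ando_power_mean_projection [OF sa(1) PP that p(3)])
  have mQ: "m Q (b *\<^sub>R Q) = power_mean_fun p b *\<^sub>R Q" if "0 \<le> b" for b
    unfolding m_def by (rule kubo_ando_power_mean_projection [OF sa(2) QQ that p(3)])
  have IP': "m id_blinfun P = 1 *\<^sub>R P + ?k *\<^sub>R (id_blinfun - P)"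
    using IP [of 1 0] by simp
  show ?thesis
  proof (cases "0 < p")
    case True
    have k: "0 < ?k" "?k < 1"
      using power_mean_fun_pos [of 0 p] power_mean_fun_strict_mono [of p 0 1] True by auto
    define s where "s = (1 / 1 + 1 / ?k) / 2"
    define n where "n = (power_mean_fun p (?k * s) - ?k) / s"
    have "0 < s" and ks: "?k * s = (1 + ?k) / 2"
      using k by (simp_all add: s_def field_simps add_pos_pos)
    have IQ': "m id_blinfun Q = 1 *\<^sub>R Q + ?k *\<^sub>R (id_blinfun - Q)"
      using IQ [of 1 0] by simp
    \<comment> \<open>The inner means are P + k(I - P) and kQ, where k is the representing function
      at 0. The other side arises by exchanging P and Q, so both carry the same scalar n.\<close>
    have L: "m (m id_blinfun P) (m Q 0) = ?k *\<^sub>R (1 *\<^sub>R P + ?k *\<^sub>R (id_blinfun - P)) + n *\<^sub>R Q"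
      using PQ [of 1 ?k ?k] mQ [of 0] k by (simp only: IP' n_def s_def) simp
    have R: "m (m id_blinfun Q) (m P 0) = ?k *\<^sub>R (1 *\<^sub>R Q + ?k *\<^sub>R (id_blinfun - Q)) + n *\<^sub>R P"
      using QP [of 1 ?k ?k] mP [of 0] k by (simp only: IQ' n_def s_def) simp
    have "m (m id_blinfun P) (m Q 0) \<noteq> m (m id_blinfun Q) (m P 0)"
    proof
      assume "m (m id_blinfun P) (m Q 0) = m (m id_blinfun Q) (m P 0)"
      \<comment> \<open>Evaluating both forms at e, where P has value 1 and Q has value 1/2, leaves
        one scalar equation for n.\<close>
      then have "inner ((?k *\<^sub>R (1 *\<^sub>R P + ?k *\<^sub>R (id_blinfun - P)) + n *\<^sub>R Q) e) e
          = inner ((?k *\<^sub>R (1 *\<^sub>R Q + ?k *\<^sub>R (id_blinfun - Q)) + n *\<^sub>R P) e) e"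
        unfolding L R by simp
      moreover have "inner e e = 1"
        using e by (simp add: norm_eq_1)
      ultimately have "?k + n / 2 = ?k * ((1 + ?k) / 2) + n"
        by (simp add: blinfun.add_left blinfun.diff_left blinfun.scaleR_left inner_add_left
            inner_diff_left Pe Qe field_simps)
      then have "n = ?k * (1 - ?k)"
        by (simp add: field_simps)
      \<comment> \<open>The equation places the graph at ks = (1 + k)/2 on the chord through (0, k)
        and (1, 1), contrary to strict concavity.\<close>
      then have "power_mean_fun p (?k * s) - ?k = (1 - ?k) * (?k * s)"
        using \<open>0 < s\<close> by (simp add: n_def field_simps)
      then have "power_mean_fun p ((1 + ?k) / 2) = ?k + (1 - ?k) * ((1 + ?k) / 2)"
        unfolding ks by simp
      moreover have "(1 - (1 + ?k) / 2) * ?k + ((1 + ?k) / 2 - 0) * power_mean_fun p 1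
          < (1 - 0) * power_mean_fun p ((1 + ?k) / 2)"
        using k True p by (intro power_mean_fun_strict_concave) auto
      ultimately show False
        by (simp add: field_simps)
    qed
    then show ?thesis
      using pos pos0 by blast
  next
    case False
    define q where "q = - p"
    have q: "0 < q" "q < 1" "p = - q"
      using False p by (auto simp: q_def)
    let ?g = "power_mean_fun q"
    have k: "?k = 0"
      using q by (simp add: power_mean_fun_def)
    have gpos: "0 < ?g t" if "0 \<le> t" for t
      using power_mean_fun_pos that q(1) by blast
    have inv: "power_mean_fun p t = 1 / ?g (1 / t)" if "0 < t" for t
      using power_mean_fun_minus [OF q(1) that] by (simp add: q(3))
    have quot: "power_mean_fun p t / t = 1 / ?g t" if "0 < t" for t
      using power_mean_fun_minus' [OF q(1), of t] that by (simp add: q(3))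
    \<comment> \<open>The inverse eigenvalues of B are 1/2 and 1, with average 3/4; Jensen's
      inequality will be tested at this midpoint.\<close>
    define B where "B = 2 *\<^sub>R Q + 1 *\<^sub>R (id_blinfun - Q)"
    have "B \<in> ops_between 1 2"
      unfolding B_def by (rule projection_combination_between [OF sa(2) QQ]) auto
    then have "B \<in> pos_ops"
      by (rule ops_between_pos) simp
    have IP'': "m id_blinfun P = P"
      using IP' k by simp
    \<comment> \<open>As k = 0, a mean of an invertible operator with P is the multiple of P by
      \<open>power_mean_fun p s / s\<close>, which is the reciprocal of g at s.\<close>
    have BP: "m B P = (1 / ?g (3 / 4)) *\<^sub>R P"
      using QP [of 2 1 1] k quot [of "3 / 4"] by (simp add: B_def)
    have L: "m (m id_blinfun P) (m B P) = (1 / ?g (?g (3 / 4))) *\<^sub>R P"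
      using gpos [of "3 / 4"] by (simp add: IP'' BP mP inv)
    define b where "b = 1 / ?g (1 / 2)"
    define s where "s = (1 + ?g (1 / 2)) / 2"
    have "0 < b" "0 < s"
      using gpos [of "1 / 2"] by (simp_all add: b_def s_def add_pos_pos)
    have IB: "m id_blinfun B = b *\<^sub>R Q + 1 *\<^sub>R (id_blinfun - Q)"
      using IQ [of 2 1] by (simp add: B_def b_def inv)
    have "(1 / b + 1 / 1) / 2 = s"
      by (simp add: b_def s_def)
    \<comment> \<open>Here s averages g(1/2) and g(1) = 1, while the other side contains g at the
      average 3/4 of 1/2 and 1. Equality would thus be midpoint affinity of g, once the outer
      strictly increasing g is cancelled.\<close>
    then have R: "m (m id_blinfun B) (m P P) = (1 / ?g s) *\<^sub>R P"
      using QP [of b 1 1] \<open>0 < b\<close> k quot [OF \<open>0 < s\<close>] mP [of 1] unfolding IB by simp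
    have "m (m id_blinfun P) (m B P) \<noteq> m (m id_blinfun B) (m P P)"
    proof
      assume "m (m id_blinfun P) (m B P) = m (m id_blinfun B) (m P P)"
      then have "inner (((1 / ?g (?g (3 / 4))) *\<^sub>R P) e) e = inner (((1 / ?g s) *\<^sub>R P) e) e"
        unfolding L R by (simp only:)
      then have "?g (?g (3 / 4)) = ?g s"
        by (simp add: blinfun.scaleR_left Pe)
      moreover have "(1 - 3 / 4) * ?g (1 / 2) + (3 / 4 - 1 / 2) * ?g 1 < (1 - 1 / 2) * ?g (3 / 4)"
        using q by (intro power_mean_fun_strict_concave) auto
      then have "s < ?g (3 / 4)"
        by (simp add: s_def)
      then have "?g s < ?g (?g (3 / 4))"
        using q(1) \<open>0 < s\<close> by (intro power_mean_fun_strict_mono) auto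
      ultimately show False
        by simp
    qed
    then show ?thesis
      using pos \<open>B \<in> pos_ops\<close> by blast
  qed
qed

theorem theorem6:
  fixes p :: real
  assumes "-1 < p" and "p < 1" and "p \<noteq> 0"
    and "\<exists>S :: 'a::complex_hilbert_space set. card S = 2 \<and> complex_vector.independent S"
  shows "\<not> (\<exists>\<phi> :: ('a \<Rightarrow>\<^sub>L 'a) \<Rightarrow> ('a \<Rightarrow>\<^sub>L 'a).
    bij_betw \<phi> pos_ops pos_ops \<and>
    (\<forall>A \<in> pos_ops. \<forall>B \<in> pos_ops.
       \<phi> (conventional_power_mean p A B) = kubo_ando_power_mean p (\<phi> A) (\<phi> B)))"
proof
  let ?c = "conventional_power_mean p" and ?m = "kubo_ando_power_mean p"
  assume "\<exists>\<phi> :: ('a \<Rightarrow>\<^sub>L 'a) \<Rightarrow> ('a \<Rightarrow>\<^sub>L 'a). bij_betw \<phi> pos_ops pos_ops \<and>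
    (\<forall>A \<in> pos_ops. \<forall>B \<in> pos_ops. \<phi> (?c A B) = ?m (\<phi> A) (\<phi> B))"
  then obtain \<phi> :: "('a \<Rightarrow>\<^sub>L 'a) \<Rightarrow> ('a \<Rightarrow>\<^sub>L 'a)" where bij: "bij_betw \<phi> pos_ops pos_ops"
    and \<phi>: "\<And>A B. A \<in> pos_ops \<Longrightarrow> B \<in> pos_ops \<Longrightarrow> \<phi> (?c A B) = ?m (\<phi> A) (\<phi> B)"
    by blast
  obtain X Y Z W :: "'a \<Rightarrow>\<^sub>L 'a" where "X \<in> pos_ops" "Y \<in> pos_ops" "Z \<in> pos_ops" "W \<in> pos_ops"
    and ne: "?m (?m X Y) (?m Z W) \<noteq> ?m (?m X Z) (?m Y W)"
    using kubo_ando_power_mean_not_bisymmetric [OF assms] by blast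
  then have "X \<in> \<phi> ` pos_ops" "Y \<in> \<phi> ` pos_ops" "Z \<in> \<phi> ` pos_ops" "W \<in> \<phi> ` pos_ops"
    by (simp_all add: bij_betw_imp_surj_on [OF bij])
  then obtain A B C D where pos: "A \<in> pos_ops" "B \<in> pos_ops" "C \<in> pos_ops" "D \<in> pos_ops"
    and eq: "X = \<phi> A" "Y = \<phi> B" "Z = \<phi> C" "W = \<phi> D"
    by (elim imageE) blast
  note cpos = conventional_power_mean_pos [OF _ _ assms(3)]
  have "?m (?m X Y) (?m Z W) = \<phi> (?c (?c A B) (?c C D))"
    using pos by (simp add: eq \<phi> cpos)
  also have "\<dots> = \<phi> (?c (?c A C) (?c B D))"
    using conventional_power_mean_bisymmetric [OF pos assms(3)] by simp
  also have "\<dots> = ?m (?m X Z) (?m Y W)"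
    using pos by (simp add: eq \<phi> cpos)
  finally show False
    using ne by simp
qed

end
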